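(* Let $n\geqslant2$ and let $C$ be the set of $\xi\in\mathbb Z^n$ with $|\xi_1|+|\xi_2|+\dots+|\xi_{n-1}|\leqslant\xi_n$. Let $u\colon\mathbb Z^n\to\mathbb C$ satisfy \[\frac1R\sum_{\xi\in\mathbb Z^n,\,|\xi|\leqslant R}|u(\xi)|^2\longrightarrow0\quad(R\to\infty),\] let $f\in\ell^2(\mathbb Z^n)$ satisfy $e^{\gamma\left\langle\cdot\right\rangle}f\in\ell^2(\mathbb Z^n)$ for all $\gamma\in\mathbb R_+$ and $f(\xi)=0$ for all $\xi\in C$, let $\lambda\in\left]0,n\right[$, and assume $(-\Delta_{\mathrm{disc}}-\lambda)u=f$ in $\mathbb Z^n$. Then $u(\xi)=0$ for all $\xi\in C$.
   Context: $\left\langle \xi\right\rangle=\sqrt{1+|\xi|^2}$. For $u\colon\mathbb Z^n\to\mathbb C$, the discrete Laplacian is defined by $(-\Delta_{\mathrm{disc}}u)(\xi)=\frac n2u(\xi)-\frac14\sum_{\ell=1}^n\bigl(u(\xi+e_\ell)+u(\xi-e_\ell)\bigr)$, where $e_1,\dots,e_n$ is the standard basis of $\mathbb R^n$. *)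

theory Defs
  imports "HOL-Analysis.Analysis"
begin

text \<open>Points of Z^n are represented as functions nat => int vanishing outside {0..<n};
  coordinate xi_k of the paper (k = 1..n) is xi (k-1).\<close>

definition lattice :: "nat \<Rightarrow> (nat \<Rightarrow> int) set" where
  "lattice n = {\<xi>. \<forall>i\<ge>n. \<xi> i = 0}"

definition lat_norm :: "nat \<Rightarrow> (nat \<Rightarrow> int) \<Rightarrow> real" where
  "lat_norm n \<xi> = sqrt (\<Sum>i<n. (real_of_int (\<xi> i))\<^sup>2)"

definition japanese :: "nat \<Rightarrow> (nat \<Rightarrow> int) \<Rightarrow> real" where
  "japanese n \<xi> = sqrt (1 + (lat_norm n \<xi>)\<^sup>2)"

definition disc_lap_neg :: "nat \<Rightarrow> ((nat \<Rightarrow> int) \<Rightarrow> complex) \<Rightarrow> (nat \<Rightarrow> int) \<Rightarrow> complex" where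
  "disc_lap_neg n u \<xi> = of_real (real n / 2) * u \<xi>
     - (1/4) * (\<Sum>l<n. u (\<xi>(l := \<xi> l + 1)) + u (\<xi>(l := \<xi> l - 1)))"

definition cone :: "nat \<Rightarrow> (nat \<Rightarrow> int) set" where
  "cone n = {\<xi> \<in> lattice n. (\<Sum>i<n-1. \<bar>\<xi> i\<bar>) \<le> \<xi> (n-1)}"

end

theory Submission
  imports Defs "HOL-Complex_Analysis.Complex_Analysis" "HOL-Real_Asymp.Real_Asymp"
begin

text \<open>
  Write n = N + 1, split off the last coordinate m, and take Fourier series in the first N
  coordinates. The equation becomes the recurrence w(m+1) + w(m-1) - 2 a(x) w(m) = -4 f(x,m)
  with a(x) = n - 2 lam - (cos x_1 + ... + cos x_N). By Cauchy-Schwarz, the hypothesis on u allows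
  pairing the equation with a truncation at radius R of any function \<Psi> whose slices m = const
  are bounded in l^2 uniformly in m: the commutator with the truncation is O(1/R) and
  contributes o(1). There are two choices of \<Psi>.

  (1) Superpositions \<Psi> of the modes e^{i(x.xi + m theta)} with cos theta = a(x), |a(x)| < 1,
  solve the homogeneous equation, so the Fourier transform of f vanishes at these frequencies.
  Equivalently, the sum over xi of f(xi) e^{i x.xi} U_{m-k}(a(x)) with Chebyshev polynomials U
  vanishes for all k where |a(x)| < 1. As f decays superexponentially, this sum is entire in x,
  and hence it vanishes for all real x.

  (2) If z + 1/z = 2a and |z| \<le> 1, then the bounded sequence sgn(m) z^{|m|} solves the
  recurrence with right-hand side delta_{-1} - delta_{1}, so the pairing computes
  u(xi + e_n) - u(xi - e_n). By (1), adding z^{-m} to this kernel changes nothing on the side of f,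
  and the new kernel is 0 for m < 0 and a polynomial of degree m in a(x) for m \<ge> 0. Hence only
  the values of f in xi + C enter, and these are 0 for xi in C.

  So u is 2-periodic in the direction e_n inside C, and its mean decay forces u = 0 there.

  All Fourier integrals over the torus are replaced by averages over grids of mesh 2 pi / L with L
  larger than the diameter of the truncation, for which Bessel's equality is a finite identity.
\<close>

section \<open>Finite Fourier analysis on boxes\<close>

text \<open>Serves both for boxes of lattice points and for index sets of grid frequencies; sums of
  products over it factor into one-dimensional sums.\<close>

definition box_lat :: "nat \<Rightarrow> int set \<Rightarrow> (nat \<Rightarrow> int) set" where
  "box_lat N I = {\<eta> \<in> lattice N. \<forall>l<N. \<eta> l \<in> I}"

lemma box_lat_0: "box_lat 0 I = {\<lambda>_. 0}"
  by (auto simp: box_lat_def lattice_def)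

lemma upd_in_lattice: "l < n \<Longrightarrow> \<xi> \<in> lattice n \<Longrightarrow> \<xi>(l := j) \<in> lattice n"
  by (auto simp: lattice_def)

lemma box_lat_Suc: "box_lat (Suc N) I = (\<lambda>(\<eta>, j). \<eta>(N := j)) ` (box_lat N I \<times> I)"
proof (intro equalityI subsetI)
  fix \<xi> assume "\<xi> \<in> box_lat (Suc N) I"
  then have "\<xi>(N := 0) \<in> box_lat N I" "\<xi> N \<in> I" "\<xi> = (\<xi>(N := 0))(N := \<xi> N)"
    by (auto simp: box_lat_def lattice_def)
  then show "\<xi> \<in> (\<lambda>(\<eta>, j). \<eta>(N := j)) ` (box_lat N I \<times> I)"
    by (intro image_eqI[of _ _ "(\<xi>(N := 0), \<xi> N)"]) auto
qed (auto simp: box_lat_def lattice_def less_Suc_eq)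

lemma inj_on_lattice_upd: "inj_on (\<lambda>(\<eta>, j). \<eta>(N := j)) (lattice N \<times> I)"
proof (rule inj_onI, clarsimp)
  fix a c :: "nat \<Rightarrow> int" and j k
  assume "a \<in> lattice N" "c \<in> lattice N" and eq: "a(N := j) = c(N := k)"
  then have "a N = c N" by (simp add: lattice_def)
  moreover have "a i = c i" if "i \<noteq> N" for i using fun_cong[OF eq, of i] that by simp
  ultimately have "a = c" by (metis ext)
  then show "a = c \<and> j = k" using fun_cong[OF eq, of N] by simp
qed

lemma box_lat_subset: "box_lat N I \<subseteq> lattice N"
  by (auto simp: box_lat_def)

lemma finite_box_lat: "finite I \<Longrightarrow> finite (box_lat N I)"
  by (induction N) (auto simp: box_lat_0 box_lat_Suc)

lemma sum_box_lat_Suc: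
  "(\<Sum>\<xi>\<in>box_lat (Suc N) I. g \<xi>) = (\<Sum>\<eta>\<in>box_lat N I. \<Sum>j\<in>I. g (\<eta>(N := j)))"
proof -
  have "inj_on (\<lambda>(\<eta>, j). \<eta>(N := j)) (box_lat N I \<times> I)"
    by (rule inj_on_subset[OF inj_on_lattice_upd]) (use box_lat_subset in auto)
  then show ?thesis
    by (simp add: box_lat_Suc sum.reindex sum.cartesian_product split_def o_def)
qed

lemma sum_box_lat_prod:
  fixes g :: "nat \<Rightarrow> int \<Rightarrow> 'a :: comm_semiring_1"
  shows "(\<Sum>\<eta>\<in>box_lat N I. \<Prod>l<N. g l (\<eta> l)) = (\<Prod>l<N. \<Sum>j\<in>I. g l j)"
proof (induction N)
  case (Suc N)
  have "(\<Sum>\<eta>\<in>box_lat (Suc N) I. \<Prod>l<Suc N. g l (\<eta> l))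
      = (\<Sum>\<eta>\<in>box_lat N I. \<Sum>j\<in>I. (\<Prod>l<N. g l (\<eta> l)) * g N j)"
    unfolding sum_box_lat_Suc by (intro sum.cong refl) simp
  also have "\<dots> = (\<Sum>\<eta>\<in>box_lat N I. \<Prod>l<N. g l (\<eta> l)) * (\<Sum>j\<in>I. g N j)"
    by (simp add: sum_product)
  finally show ?case using Suc by simp
qed (simp add: box_lat_0)

lemma card_box_lat: "card (box_lat N I) = card I ^ N"
  using sum_box_lat_prod[of "\<lambda>_ _. 1::nat" N I] by simp

text \<open>A geometric sum over a full period. Its ratio is an \<open>L\<close>-th root of unity
  and differs from 1, because a nonzero \<open>d\<close> with \<open>\<bar>d\<bar> < int L\<close>
  is not a multiple of \<open>L\<close>.\<close>

lemma sum_cis_interval: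
  fixes d s :: int and L :: nat
  assumes "L > 0" and "\<bar>d\<bar> < int L"
  shows "(\<Sum>j\<in>{s..<s + int L}. cis (2 * pi * d * j / L)) = (if d = 0 then of_nat L else 0)"
proof (cases "d = 0")
  case False
  define q where "q = cis (2 * pi * d / L)"
  have "q \<noteq> 1"
  proof
    assume "q = 1"
    then have "cos (2 * pi * d / L) = 1" by (simp add: q_def complex_eq_iff)
    then obtain k :: int where "2 * pi * d / L = k * 2 * pi"
      by (auto simp: cos_one_2pi_int)
    then have "pi * real_of_int d = pi * (real_of_int k * real L)" 
      using assms(1) by (simp add: field_simps)
    then have "real_of_int d = real_of_int (k * int L)" by simp
    then have "d = k * int L" by linarith
    then have "\<bar>d\<bar> = \<bar>k\<bar> * int L" by (simp add: abs_mult)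
    with assms have "\<bar>k\<bar> * int L < 1 * int L" by simp
    then have "\<bar>k\<bar> < 1" by (rule mult_right_less_imp_less) simp
    with \<open>d = k * int L\<close> False show False by simp
  qed
  have qL: "q ^ L = 1"
  proof -
    have "real L * (2 * pi * d / L) = 2 * pi * real_of_int d" using assms(1) by simp
    then show ?thesis unfolding q_def Complex.DeMoivre by (simp only: cis_multiple_2pi Ints_of_int)
  qed
  have tm: "cis (2 * pi * d * (s + int i) / L) = cis (2 * pi * d * s / L) * q ^ i" for i
    unfolding q_def Complex.DeMoivre cis_mult by (rule arg_cong[of _ _ cis]) (simp add: distrib_left add_divide_distrib mult_ac)
  have "(\<Sum>j\<in>{s..<s + int L}. cis (2 * pi * d * j / L))
      = (\<Sum>i<L. cis (2 * pi * d * real_of_int (s + int i) / L))"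
    by (rule sum.reindex_bij_witness[of _ "\<lambda>i. s + int i" "\<lambda>j. nat (j - s)"]) auto
  also have "\<dots> = (\<Sum>i<L. cis (2 * pi * d * s / L) * q ^ i)"
    by (simp only: tm)
  also have "\<dots> = 0"
    using \<open>q \<noteq> 1\<close> qL by (simp add: sum_distrib_left[symmetric] geometric_sum)
  finally show ?thesis using False by simp
qed simp

text \<open>The plane wave e^{i x.xi} in the first \<open>N\<close> coordinates. On points of
  Z^(N+1) it ignores the last coordinate.\<close>

definition plane :: "nat \<Rightarrow> (nat \<Rightarrow> real) \<Rightarrow> (nat \<Rightarrow> int) \<Rightarrow> complex" where
  "plane N x \<xi> = cis (\<Sum>l<N. x l * \<xi> l)"

lemma norm_plane [simp]: "cmod (plane N x \<xi>) = 1"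
  by (simp add: plane_def)

lemma cis_sum: "cis (\<Sum>i\<in>A. g i) = (\<Prod>i\<in>A. cis (g i))"
  by (induction A rule: infinite_finite_induct) (auto simp flip: cis_mult)

lemma sum_box_lat_cis:
  fixes d :: "nat \<Rightarrow> int" and s :: int and L :: nat
  assumes "L > 0" and "\<And>l. l < N \<Longrightarrow> \<bar>d l\<bar> < int L"
  shows "(\<Sum>\<eta>\<in>box_lat N {s..<s + int L}. cis (\<Sum>l<N. 2 * pi * d l * \<eta> l / L))
       = (if \<forall>l<N. d l = 0 then of_nat L ^ N else 0)"
proof -
  have "(\<Sum>\<eta>\<in>box_lat N {s..<s + int L}. cis (\<Sum>l<N. 2 * pi * d l * \<eta> l / L))
      = (\<Prod>l<N. if d l = 0 then of_nat L else 0)"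
    unfolding cis_sum sum_box_lat_prod[of "\<lambda>l j. cis (2 * pi * d l * j / L)"]
    by (rule prod.cong) (use assms in \<open>simp_all add: sum_cis_interval\<close>)
  also have "\<dots> = (if \<forall>l<N. d l = 0 then of_nat L ^ N else 0)"
    using assms(1) by (auto intro!: prod_zero)
  finally show ?thesis .
qed

text \<open>Frequencies of mesh 2 pi / L with base point \<open>p\<close>. The index
  \<open>y\<close> is itself an integer point, so \<open>box_lat N {0..<int L}\<close> indexes one
  full period of frequencies.\<close>

definition grid :: "(nat \<Rightarrow> real) \<Rightarrow> nat \<Rightarrow> (nat \<Rightarrow> int) \<Rightarrow> nat \<Rightarrow> real" where
  "grid p L y l = p l + 2 * pi * y l / L"

text \<open>Distinct grid frequencies give orthogonal plane waves on every box of side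
  \<open>L\<close>. A proper part \<open>Y\<close> of the grid allows superpositions localized near
  \<open>p\<close>; the free corner \<open>s\<close> allows boxes around 0.\<close>

lemma bessel:
  fixes c :: "(nat \<Rightarrow> int) \<Rightarrow> complex"
  assumes L: "L > 0" and Y: "Y \<subseteq> box_lat N {0..<int L}"
  shows "(\<Sum>\<eta>\<in>box_lat N {s..<s + int L}. (cmod (\<Sum>y\<in>Y. c y * plane N (grid p L y) \<eta>))\<^sup>2)
       = L ^ N * (\<Sum>y\<in>Y. (cmod (c y))\<^sup>2)"
proof -
  let ?B = "box_lat N {s..<s + int L}"
  have fY: "finite Y" using Y finite_box_lat finite_subset by blast
  have orth: "(\<Sum>\<eta>\<in>?B. plane N (grid p L y) \<eta> * cnj (plane N (grid p L y') \<eta>))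
      = (if y' = y then of_nat L ^ N else 0)" if "y \<in> Y" "y' \<in> Y" for y y'
  proof -
    have yy: "y \<in> box_lat N {0..<int L}" "y' \<in> box_lat N {0..<int L}" using that Y by auto
    have "plane N (grid p L y) \<eta> * cnj (plane N (grid p L y') \<eta>)
        = cis (\<Sum>l<N. 2 * pi * of_int (y l - y' l) * \<eta> l / L)" for \<eta>
      unfolding plane_def cis_cnj cis_mult 
      by (simp add: grid_def sum_negf[symmetric] sum.distrib[symmetric] algebra_simps diff_divide_distrib)
    moreover have "\<bar>y l - y' l\<bar> < int L" if "l < N" for l
      using yy that by (fastforce simp: box_lat_def)
    moreover have "(\<forall>l<N. y l - y' l = 0) \<longleftrightarrow> y' = y"
    proof
      assume eq: "\<forall>l<N. y l - y' l = 0"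
      show "y' = y"
      proof
        fix l show "y' l = y l"
          using eq yy by (cases "l < N") (auto simp: box_lat_def lattice_def)
      qed
    qed auto
    ultimately show ?thesis
      using sum_box_lat_cis[OF L, of N "\<lambda>l. y l - y' l" s] by simp
  qed
  have "complex_of_real (\<Sum>\<eta>\<in>?B. (cmod (\<Sum>y\<in>Y. c y * plane N (grid p L y) \<eta>))\<^sup>2)
      = (\<Sum>\<eta>\<in>?B. \<Sum>y\<in>Y. \<Sum>y'\<in>Y. c y * cnj (c y') * (plane N (grid p L y) \<eta> * cnj (plane N (grid p L y') \<eta>)))"
    by (simp only: of_real_sum complex_norm_square cnj_sum sum_product complex_cnj_mult) (simp add: mult_ac)
  also have "\<dots> = (\<Sum>y\<in>Y. \<Sum>y'\<in>Y. c y * cnj (c y') * (\<Sum>\<eta>\<in>?B. plane N (grid p L y) \<eta> * cnj (plane N (grid p L y') \<eta>)))"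
    unfolding sum_distrib_left
    by (subst sum.swap, rule sum.cong[OF refl], subst sum.swap) simp
  also have "\<dots> = (\<Sum>y\<in>Y. \<Sum>y'\<in>Y. c y * cnj (c y') * (if y' = y then of_nat L ^ N else 0))"
    by (intro sum.cong refl) (simp only: orth)
  also have "\<dots> = (\<Sum>y\<in>Y. c y * cnj (c y) * of_nat L ^ N)"
    using fY by (intro sum.cong refl) (simp add: if_distrib cong: if_cong)
  also have "\<dots> = complex_of_real (L ^ N * (\<Sum>y\<in>Y. (cmod (c y))\<^sup>2))"
    by (simp only: of_real_sum of_real_mult complex_norm_square sum_distrib_left) (simp add: mult_ac)
  finally show ?thesis by (simp only: of_real_eq_iff of_nat_power)
qed

section \<open>Summability of exponentials of the l1 norm\<close>

definition l1 :: "nat \<Rightarrow> (nat \<Rightarrow> int) \<Rightarrow> real" where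
  "l1 n \<xi> = (\<Sum>l<n. \<bar>real_of_int (\<xi> l)\<bar>)"

lemma finite_subset_box_lat:
  assumes "finite A" "A \<subseteq> lattice n"
  obtains m :: nat where "A \<subseteq> box_lat n {-int m..int m}"
proof -
  have fin: "finite ((\<lambda>(\<xi>, l). \<bar>\<xi> l\<bar>) ` (A \<times> {..<n}))" (is "finite ?V") using assms by simp
  define m where "m = nat (Max (insert 0 ?V))"
  have "\<bar>\<xi> l\<bar> \<le> int m" if "\<xi> \<in> A" "l < n" for \<xi> l
  proof -
    have "\<bar>\<xi> l\<bar> \<in> ?V" using that by force
    then have "\<bar>\<xi> l\<bar> \<le> Max (insert 0 ?V)" using fin by simp
    then show ?thesis unfolding m_def by linarith
  qed
  then have "A \<subseteq> box_lat n {-int m..int m}"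
    using assms(2) by (fastforce simp: box_lat_def abs_le_iff)
  then show ?thesis using that by blast
qed

lemma sum_exp_abs_le: "(\<Sum>j\<in>{-int m..int m}. exp (- \<bar>real_of_int j\<bar>)) \<le> 2 * (\<Sum>i. exp (-1) ^ i)"
proof -
  let ?g = "\<lambda>j. exp (- \<bar>real_of_int j\<bar>)"
  have sm: "summable (\<lambda>i. exp (-1::real) ^ i)" by (rule summable_geometric) simp
  have eq: "exp (-1::real) ^ i = exp (- real i)" for i
    by (simp add: exp_of_nat_mult[symmetric])
  have half: "(\<Sum>i\<le>m. exp (-1::real) ^ i) \<le> (\<Sum>i. exp (-1) ^ i)"
    by (intro sum_le_suminf sm) auto
  \<comment> \<open>Both half-lines contain 0; the double count only enlarges the bound.\<close>
  have "sum ?g {-int m..int m} \<le> sum ?g (int ` {..m} \<union> (\<lambda>i. - int i) ` {..m})"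
  proof (rule sum_mono2)
    show "{-int m..int m} \<subseteq> int ` {..m} \<union> (\<lambda>i. - int i) ` {..m}"
    proof
      fix j assume "j \<in> {-int m..int m}"
      then have "(nat j \<in> {..m} \<and> j = int (nat j)) \<or> (nat (-j) \<in> {..m} \<and> j = - int (nat (-j)))" by auto
      then show "j \<in> int ` {..m} \<union> (\<lambda>i. - int i) ` {..m}" by blast
    qed
  qed auto
  also have "\<dots> \<le> sum ?g (int ` {..m}) + sum ?g ((\<lambda>i. - int i) ` {..m})"
    by (simp add: sum_Un sum_nonneg)
  also have "\<dots> = 2 * (\<Sum>i\<le>m. exp (-1::real) ^ i)"
    by (simp add: sum.reindex inj_on_def eq)
  finally show ?thesis using half by linarith
qed

text \<open>A finite set of lattice points lies in a box, where the sum factors into one-dimensional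
  sums; the geometric bound on each factor does not depend on the box.\<close>

lemma summable_on_exp_l1: "(\<lambda>\<xi>. exp (- l1 n \<xi>)) summable_on lattice n"
proof (rule nonneg_bdd_above_summable_on)
  show "bdd_above (sum (\<lambda>\<xi>. exp (- l1 n \<xi>)) ` {F. F \<subseteq> lattice n \<and> finite F})"
  proof (rule bdd_aboveI2, clarify)
    fix F assume F: "F \<subseteq> lattice n" "finite F"
    obtain m :: nat where m: "F \<subseteq> box_lat n {-int m..int m}"
      using finite_subset_box_lat F by blast
    have "(\<Sum>\<xi>\<in>F. exp (- l1 n \<xi>)) \<le> (\<Sum>\<xi>\<in>box_lat n {-int m..int m}. \<Prod>l<n. exp (- \<bar>real_of_int (\<xi> l)\<bar>))"
      unfolding l1_def sum_negf[symmetric] exp_sum[OF finite_lessThan]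
      by (rule sum_mono2) (use m finite_box_lat in \<open>auto simp: prod_nonneg\<close>)
    also have "\<dots> = (\<Prod>l<n. \<Sum>j\<in>{-int m..int m}. exp (- \<bar>real_of_int j\<bar>))"
      by (rule sum_box_lat_prod)
    also have "\<dots> \<le> (\<Prod>l<n. 2 * (\<Sum>i. exp (-1) ^ i))"
      by (rule prod_mono) (use sum_exp_abs_le in \<open>auto intro: sum_nonneg\<close>)
    finally show "(\<Sum>\<xi>\<in>F. exp (- l1 n \<xi>)) \<le> (\<Prod>l<n. 2 * (\<Sum>i. exp (-1) ^ i))" .
  qed
qed simp

section \<open>Truncation and the commutator estimate\<close>

lemma lat_norm_L2_set: "lat_norm n \<xi> = L2_set (\<lambda>i. real_of_int (\<xi> i)) {..<n}"
  by (simp add: lat_norm_def L2_set_def)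

lemma abs_le_lat_norm: "l < n \<Longrightarrow> \<bar>real_of_int (\<xi> l)\<bar> \<le> lat_norm n \<xi>"
  unfolding lat_norm_L2_set using member_le_L2_set[of "{..<n}" l "\<lambda>i. \<bar>real_of_int (\<xi> i)\<bar>"]
  by (simp add: L2_set_def)

lemma lat_norm_upd_le: "lat_norm n (\<xi>(l := \<xi> l + d)) \<le> lat_norm n \<xi> + \<bar>d\<bar>"
proof -
  have "lat_norm n (\<xi>(l := \<xi> l + d)) = L2_set (\<lambda>i. real_of_int (\<xi> i) + (if i = l then real_of_int d else 0)) {..<n}"
    unfolding lat_norm_L2_set by (rule L2_set_cong) auto
  also have "\<dots> \<le> lat_norm n \<xi> + L2_set (\<lambda>i. if i = l then real_of_int d else 0) {..<n}"
    unfolding lat_norm_L2_set by (rule L2_set_triangle_ineq)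
  also have "L2_set (\<lambda>i. if i = l then real_of_int d else 0) {..<n} \<le> (\<Sum>i<n. \<bar>if i = l then real_of_int d else 0\<bar>)"
    by (rule L2_set_le_sum_abs)
  also have "\<dots> \<le> \<bar>real_of_int d\<bar>"
    by (simp add: if_distrib[of abs] cong: if_cong)
  finally show ?thesis by simp
qed

lemma abs_lat_norm_upd_diff_le: "\<bar>lat_norm n (\<xi>(l := \<xi> l + d)) - lat_norm n \<xi>\<bar> \<le> \<bar>d\<bar>"
  using lat_norm_upd_le[of n \<xi> l d] lat_norm_upd_le[of n "\<xi>(l := \<xi> l + d)" l "-d"] by simp

definition lat_ball :: "nat \<Rightarrow> real \<Rightarrow> (nat \<Rightarrow> int) set" where
  "lat_ball n s = {\<xi> \<in> lattice n. lat_norm n \<xi> \<le> s}"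

lemma lat_ball_subset_box: "lat_ball n s \<subseteq> box_lat n {-\<lfloor>s\<rfloor>..\<lfloor>s\<rfloor>}"
proof
  fix \<xi> assume "\<xi> \<in> lat_ball n s"
  then have \<xi>: "\<xi> \<in> lattice n" "lat_norm n \<xi> \<le> s" by (auto simp: lat_ball_def)
  have "\<bar>\<xi> l\<bar> \<le> \<lfloor>s\<rfloor>" if "l < n" for l
    using abs_le_lat_norm[OF that, of \<xi>] \<xi>(2) by (simp add: le_floor_iff)
  then show "\<xi> \<in> box_lat n {-\<lfloor>s\<rfloor>..\<lfloor>s\<rfloor>}"
    using \<xi>(1) by (fastforce simp: box_lat_def abs_le_iff)
qed

lemma finite_lat_ball: "finite (lat_ball n s)"
  using finite_box_lat lat_ball_subset_box by (rule finite_subset[rotated]) simp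

lemma lat_ball_upd:
  "l < n \<Longrightarrow> \<bar>d\<bar> \<le> 1 \<Longrightarrow> \<xi> \<in> lat_ball n s \<Longrightarrow> \<xi>(l := \<xi> l + d) \<in> lat_ball n (s + 1)"
  using lat_norm_upd_le[of n \<xi> l d] by (auto simp: lat_ball_def intro: upd_in_lattice)

text \<open>Summation by parts without boundary terms: \<open>v\<close> lives in radius
  \<open>s\<close>, and a unit shift of its support stays within radius \<open>s + 1\<close>. Only
  points where \<open>v\<close> is nonzero have to be matched.\<close>

lemma sum_lat_ball_shift:
  fixes g v :: "(nat \<Rightarrow> int) \<Rightarrow> complex"
  assumes v: "\<And>\<xi>. \<xi> \<in> lattice n \<Longrightarrow> lat_norm n \<xi> > s \<Longrightarrow> v \<xi> = 0" and "l < n" "\<bar>d\<bar> \<le> 1"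
  shows "(\<Sum>\<xi>\<in>lat_ball n (s + 1). g \<xi> * v (\<xi>(l := \<xi> l + d)))
       = (\<Sum>\<xi>\<in>lat_ball n (s + 1). g (\<xi>(l := \<xi> l - d)) * v \<xi>)"
proof (rule sum.reindex_bij_witness_not_neutral[where
      S' = "{\<xi> \<in> lat_ball n (s + 1). v (\<xi>(l := \<xi> l + d)) = 0}" and
      T' = "{\<xi> \<in> lat_ball n (s + 1). v \<xi> = 0}" and
      i = "\<lambda>\<xi>. \<xi>(l := \<xi> l - d)" and j = "\<lambda>\<xi>. \<xi>(l := \<xi> l + d)"])
  fix \<xi> assume \<xi>: "\<xi> \<in> lat_ball n (s + 1) - {\<xi> \<in> lat_ball n (s + 1). v (\<xi>(l := \<xi> l + d)) = 0}"
  then have "\<xi>(l := \<xi> l + d) \<in> lattice n" "v (\<xi>(l := \<xi> l + d)) \<noteq> 0"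
    using \<open>l < n\<close> by (auto simp: lat_ball_def intro: upd_in_lattice)
  then have "\<xi>(l := \<xi> l + d) \<in> lat_ball n (s + 1)"
    using v[of "\<xi>(l := \<xi> l + d)"] by (force simp: lat_ball_def)
  then show "\<xi>(l := \<xi> l + d) \<in> lat_ball n (s + 1) - {\<xi> \<in> lat_ball n (s + 1). v \<xi> = 0}"
    using \<open>v (\<xi>(l := \<xi> l + d)) \<noteq> 0\<close> by simp
next
  fix \<xi> assume \<xi>: "\<xi> \<in> lat_ball n (s + 1) - {\<xi> \<in> lat_ball n (s + 1). v \<xi> = 0}"
  then have "\<xi> \<in> lat_ball n s"
    using v[of \<xi>] by (force simp: lat_ball_def)
  from lat_ball_upd[OF \<open>l < n\<close> _ this, of "- d"] \<open>\<bar>d\<bar> \<le> 1\<close>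
  show "\<xi>(l := \<xi> l - d) \<in> lat_ball n (s + 1) - {\<xi> \<in> lat_ball n (s + 1). v (\<xi>(l := \<xi> l + d)) = 0}"
    using \<xi> by simp
qed (auto simp: finite_lat_ball)

lemma disc_lap_neg_symmetric:
  fixes g v :: "(nat \<Rightarrow> int) \<Rightarrow> complex"
  assumes v: "\<And>\<xi>. \<xi> \<in> lattice n \<Longrightarrow> lat_norm n \<xi> > s \<Longrightarrow> v \<xi> = 0"
  shows "(\<Sum>\<xi>\<in>lat_ball n (s + 1). g \<xi> * disc_lap_neg n v \<xi>)
       = (\<Sum>\<xi>\<in>lat_ball n (s + 1). disc_lap_neg n g \<xi> * v \<xi>)"
proof -
  let ?B = "lat_ball n (s + 1)"
  have shift: "(\<Sum>\<xi>\<in>?B. g \<xi> * (v (\<xi>(l := \<xi> l + 1)) + v (\<xi>(l := \<xi> l - 1))))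
      = (\<Sum>\<xi>\<in>?B. (g (\<xi>(l := \<xi> l + 1)) + g (\<xi>(l := \<xi> l - 1))) * v \<xi>)" if "l < n" for l
    using sum_lat_ball_shift[of n s v l 1 g, OF v that] sum_lat_ball_shift[of n s v l "-1" g, OF v that]
    by (simp add: distrib_left distrib_right sum.distrib)
  have "(\<Sum>\<xi>\<in>?B. g \<xi> * (\<Sum>l<n. v (\<xi>(l := \<xi> l + 1)) + v (\<xi>(l := \<xi> l - 1))))
      = (\<Sum>\<xi>\<in>?B. (\<Sum>l<n. g (\<xi>(l := \<xi> l + 1)) + g (\<xi>(l := \<xi> l - 1))) * v \<xi>)"
    unfolding sum_distrib_left sum_distrib_right
    by (subst (1 2) sum.swap) (use shift in \<open>simp add: sum_distrib_left sum_distrib_right\<close>)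
  then show ?thesis
    by (simp add: disc_lap_neg_def right_diff_distrib left_diff_distrib sum_subtractf mult_ac
        flip: sum_distrib_left sum_divide_distrib)
qed

text \<open>A tent rather than a sharp truncation: its Lipschitz constant \<open>1 / s\<close> is
  the source of the O(1/R) in the commutator.\<close>

definition cutoff :: "nat \<Rightarrow> real \<Rightarrow> (nat \<Rightarrow> int) \<Rightarrow> real" where
  "cutoff n s \<xi> = max 0 (1 - lat_norm n \<xi> / s)"

lemma cutoff_nonneg: "0 \<le> cutoff n s \<xi>"
  by (simp add: cutoff_def)

lemma lat_norm_nonneg: "0 \<le> lat_norm n \<xi>"
  by (simp add: lat_norm_def sum_nonneg)

lemma cutoff_le_1: "s > 0 \<Longrightarrow> cutoff n s \<xi> \<le> 1"
  by (simp add: cutoff_def lat_norm_nonneg)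

lemma cutoff_eq_0: "s > 0 \<Longrightarrow> lat_norm n \<xi> > s \<Longrightarrow> cutoff n s \<xi> = 0"
  by (simp add: cutoff_def field_simps)

lemma cutoff_lipschitz:
  assumes "s > 0" "\<bar>d\<bar> \<le> 1"
  shows "\<bar>cutoff n s (\<xi>(l := \<xi> l + d)) - cutoff n s \<xi>\<bar> \<le> 1 / s"
proof -
  have "\<bar>cutoff n s (\<xi>(l := \<xi> l + d)) - cutoff n s \<xi>\<bar> \<le> \<bar>lat_norm n (\<xi>(l := \<xi> l + d)) / s - lat_norm n \<xi> / s\<bar>"
    unfolding cutoff_def by linarith
  also have "\<dots> = \<bar>lat_norm n (\<xi>(l := \<xi> l + d)) - lat_norm n \<xi>\<bar> / s"
    using assms(1) by (simp flip: diff_divide_distrib)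
  also have "\<dots> \<le> 1 / s"
    using abs_lat_norm_upd_diff_le[of n \<xi> l d] assms by (intro divide_right_mono) linarith+
  finally show ?thesis .
qed

text \<open>By symmetry the Laplacian moves from \<open>u\<close> to the truncated
  \<open>\<Psi>\<close>, so the difference of the pairings is the commutator with the cutoff. It
  consists of 2 n shifted terms with factors at most 1/(4 s), each estimated by Cauchy-Schwarz; the
  shifts enlarge the radius for \<open>\<Psi>\<close> to \<open>s + 2\<close>.\<close>

lemma commutator_bound:
  fixes u \<Psi> :: "(nat \<Rightarrow> int) \<Rightarrow> complex" and lam :: real
  assumes s: "s > 0"
  shows "cmod ((\<Sum>\<xi>\<in>lat_ball n (s + 1). u \<xi> * cutoff n s \<xi> * (disc_lap_neg n \<Psi> \<xi> - lam * \<Psi> \<xi>))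
         - (\<Sum>\<xi>\<in>lat_ball n (s + 1). (disc_lap_neg n u \<xi> - lam * u \<xi>) * cutoff n s \<xi> * \<Psi> \<xi>))
       \<le> n / (2 * s) * (sqrt (\<Sum>\<xi>\<in>lat_ball n (s + 1). (cmod (u \<xi>))\<^sup>2) * sqrt (\<Sum>\<xi>\<in>lat_ball n (s + 2). (cmod (\<Psi> \<xi>))\<^sup>2))"
    (is "cmod (?X - ?Y) \<le> n / (2 * s) * (?U * ?P)")
proof -
  let ?B = "lat_ball n (s + 1)" and ?c = "cutoff n s"
  define v where "v \<xi> = ?c \<xi> * \<Psi> \<xi>" for \<xi>
  have v0: "v \<xi> = 0" if "lat_norm n \<xi> > s" for \<xi>
    using cutoff_eq_0[OF s that] by (simp add: v_def)
  have "?Y = (\<Sum>\<xi>\<in>?B. disc_lap_neg n u \<xi> * v \<xi>) - (\<Sum>\<xi>\<in>?B. lam * u \<xi> * v \<xi>)"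
    by (simp add: v_def algebra_simps sum_subtractf)
  also have "\<dots> = (\<Sum>\<xi>\<in>?B. u \<xi> * (disc_lap_neg n v \<xi> - lam * v \<xi>))"
    using disc_lap_neg_symmetric[of n s v u] v0 by (simp add: algebra_simps sum_subtractf)
  finally have "?X - ?Y = (\<Sum>\<xi>\<in>?B. u \<xi> * (?c \<xi> * disc_lap_neg n \<Psi> \<xi> - disc_lap_neg n v \<xi>))"
    by (simp add: sum_subtractf v_def algebra_simps)
  also have "cmod \<dots> \<le> (\<Sum>\<xi>\<in>?B. cmod (u \<xi>) * (1 / (4 * s) *
      (\<Sum>l<n. cmod (\<Psi> (\<xi>(l := \<xi> l + 1))) + cmod (\<Psi> (\<xi>(l := \<xi> l - 1))))))"
  proof (rule sum_norm_le, unfold norm_mult, rule mult_left_mono)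
    fix \<xi>
    have lip1: "\<bar>?c (\<xi>(l := \<xi> l + 1)) - ?c \<xi>\<bar> \<le> 1 / s" for l
      by (rule cutoff_lipschitz[OF s]) simp
    have lip2: "\<bar>?c (\<xi>(l := \<xi> l - 1)) - ?c \<xi>\<bar> \<le> 1 / s" for l
      using cutoff_lipschitz[OF s, of "-1" n \<xi> l] by simp
    have termwise: "cmod (of_real (?c (\<xi>(l := \<xi> l + 1)) - ?c \<xi>) * \<Psi> (\<xi>(l := \<xi> l + 1))
                       + of_real (?c (\<xi>(l := \<xi> l - 1)) - ?c \<xi>) * \<Psi> (\<xi>(l := \<xi> l - 1)))
        \<le> 1 / s * cmod (\<Psi> (\<xi>(l := \<xi> l + 1))) + 1 / s * cmod (\<Psi> (\<xi>(l := \<xi> l - 1)))" for l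
      by (rule norm_triangle_mono; unfold norm_mult norm_of_real; rule mult_right_mono[OF _ norm_ge_zero]; rule lip1 lip2)
    \<comment> \<open>The diagonal terms with factor n/2 cancel, so only increments of the cutoff
      remain.\<close>
    have expand: "?c \<xi> * disc_lap_neg n \<Psi> \<xi> - disc_lap_neg n v \<xi>
        = 1 / 4 * (\<Sum>l<n. of_real (?c (\<xi>(l := \<xi> l + 1)) - ?c \<xi>) * \<Psi> (\<xi>(l := \<xi> l + 1))
                       + of_real (?c (\<xi>(l := \<xi> l - 1)) - ?c \<xi>) * \<Psi> (\<xi>(l := \<xi> l - 1)))"
      by (simp add: disc_lap_neg_def v_def algebra_simps sum_subtractf sum.distrib sum_distrib_left)
    have "cmod (?c \<xi> * disc_lap_neg n \<Psi> \<xi> - disc_lap_neg n v \<xi>) = 1 / 4 * cmod (\<Sum>l<n. of_real (?c (\<xi>(l := \<xi> l + 1)) - ?c \<xi>) * \<Psi> (\<xi>(l := \<xi> l + 1))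
                       + of_real (?c (\<xi>(l := \<xi> l - 1)) - ?c \<xi>) * \<Psi> (\<xi>(l := \<xi> l - 1)))"
      unfolding expand by (simp only: norm_mult norm_divide norm_one norm_numeral)
    also have "\<dots> \<le> 1 / 4 * (\<Sum>l<n. 1 / s * cmod (\<Psi> (\<xi>(l := \<xi> l + 1))) + 1 / s * cmod (\<Psi> (\<xi>(l := \<xi> l - 1))))"
      by (intro mult_left_mono sum_norm_le termwise) simp
    also have "\<dots> = 1 / (4 * s) * (\<Sum>l<n. cmod (\<Psi> (\<xi>(l := \<xi> l + 1))) + cmod (\<Psi> (\<xi>(l := \<xi> l - 1))))"
      by (simp add: sum_divide_distrib add_divide_distrib mult.commute)
    finally show "cmod (?c \<xi> * disc_lap_neg n \<Psi> \<xi> - disc_lap_neg n v \<xi>)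
        \<le> 1 / (4 * s) * (\<Sum>l<n. cmod (\<Psi> (\<xi>(l := \<xi> l + 1))) + cmod (\<Psi> (\<xi>(l := \<xi> l - 1))))" .
  qed simp
  also have "\<dots> = 1 / (4 * s) * (\<Sum>l<n. (\<Sum>\<xi>\<in>?B. cmod (u \<xi>) * cmod (\<Psi> (\<xi>(l := \<xi> l + 1)))) +
      (\<Sum>\<xi>\<in>?B. cmod (u \<xi>) * cmod (\<Psi> (\<xi>(l := \<xi> l - 1)))))"
    unfolding sum.distrib[symmetric] distrib_left[symmetric] 
    by (subst sum.swap) (simp add: sum_distrib_left mult_ac)
  also have "\<dots> \<le> 1 / (4 * s) * (\<Sum>l<n. ?U * ?P + ?U * ?P)"
  proof (intro mult_left_mono sum_mono add_mono)
    have cs: "(\<Sum>\<xi>\<in>?B. cmod (u \<xi>) * cmod (\<Psi> (\<xi>(l := \<xi> l + d)))) \<le> ?U * ?P" if "l < n" "\<bar>d\<bar> \<le> 1" for l d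
    proof -
      have inj: "inj_on (\<lambda>\<xi>. \<xi>(l := \<xi> l + d)) ?B"
        by (rule inj_on_inverseI[where g = "\<lambda>\<xi>. \<xi>(l := \<xi> l - d)"]) simp
      have sub: "(\<lambda>\<xi>. \<xi>(l := \<xi> l + d)) ` ?B \<subseteq> lat_ball n (s + 2)"
        using lat_ball_upd[OF that, of _ "s + 1"] by (auto simp: add.assoc)
      have "(\<Sum>\<xi>\<in>?B. (cmod (\<Psi> (\<xi>(l := \<xi> l + d))))\<^sup>2) = (\<Sum>\<xi>\<in>(\<lambda>\<xi>. \<xi>(l := \<xi> l + d)) ` ?B. (cmod (\<Psi> \<xi>))\<^sup>2)"
        by (simp add: sum.reindex[OF inj])
      also have "\<dots> \<le> (\<Sum>\<xi>\<in>lat_ball n (s + 2). (cmod (\<Psi> \<xi>))\<^sup>2)"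
        by (rule sum_mono2[OF finite_lat_ball sub]) simp
      finally have le: "L2_set (\<lambda>\<xi>. cmod (\<Psi> (\<xi>(l := \<xi> l + d)))) ?B \<le> ?P"
        by (simp add: L2_set_def)
      have "(\<Sum>\<xi>\<in>?B. cmod (u \<xi>) * cmod (\<Psi> (\<xi>(l := \<xi> l + d)))) 
          \<le> L2_set (\<lambda>\<xi>. cmod (u \<xi>)) ?B * L2_set (\<lambda>\<xi>. cmod (\<Psi> (\<xi>(l := \<xi> l + d)))) ?B"
        using L2_set_mult_ineq[of "\<lambda>\<xi>. cmod (u \<xi>)" "\<lambda>\<xi>. cmod (\<Psi> (\<xi>(l := \<xi> l + d)))" ?B] by simp
      also have "\<dots> \<le> ?U * ?P"
        using le by (intro mult_mono) (auto simp: L2_set_def sum_nonneg)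
      finally show ?thesis .
    qed
    fix l assume "l \<in> {..<n}"
    then show "(\<Sum>\<xi>\<in>?B. cmod (u \<xi>) * cmod (\<Psi> (\<xi>(l := \<xi> l + 1)))) \<le> ?U * ?P"
      "(\<Sum>\<xi>\<in>?B. cmod (u \<xi>) * cmod (\<Psi> (\<xi>(l := \<xi> l - 1)))) \<le> ?U * ?P"
      using cs[of l 1] cs[of l "-1"] by auto
  qed (use s in simp)
  also have "\<dots> = n / (2 * s) * (?U * ?P)"
    using s by (simp add: field_simps)
  finally show ?thesis .
qed

section \<open>Superpositions of modes\<close>

text \<open>The function a(x) of the introduction.\<close>

definition symb :: "nat \<Rightarrow> real \<Rightarrow> (nat \<Rightarrow> real) \<Rightarrow> real" where
  "symb N lam x = real (Suc N) - 2 * lam - (\<Sum>l<N. cos (x l))"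

lemma plane_upd_last [simp]: "plane N x (\<xi>(N := j)) = plane N x \<xi>"
  unfolding plane_def by (rule arg_cong[of _ _ cis], rule sum.cong) auto

lemma plane_upd:
  assumes "l < N"
  shows "plane N x (\<xi>(l := \<xi> l + d)) = cis (x l * d) * plane N x \<xi>"
proof -
  have "(\<Sum>i<N. x i * (\<xi>(l := \<xi> l + d)) i) = (\<Sum>i<N. x i * \<xi> i + (if i = l then x l * d else 0))"
    by (rule sum.cong) (auto simp: algebra_simps)
  also have "\<dots> = x l * d + (\<Sum>i<N. x i * \<xi> i)"
    using assms by (simp add: sum.distrib)
  finally show ?thesis by (simp add: plane_def cis_mult)
qed

text \<open>Each pair of shifts in a direction \<open>l < N\<close> multiplies the plane wave by 2
  cos x_l; what is left is the one-dimensional recurrence in the last coordinate.\<close>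

lemma disc_lap_neg_mode:
  fixes N :: nat and c :: "int \<Rightarrow> complex"
  defines "\<psi> \<equiv> \<lambda>c x \<xi>. c (\<xi> N) * plane N x \<xi>"
  shows "disc_lap_neg (Suc N) (\<psi> c x) \<xi> - of_real lam * \<psi> c x \<xi>
       = - (1/4) * ((c (\<xi> N + 1) + c (\<xi> N - 1) - 2 * of_real (symb N lam x) * c (\<xi> N)) * plane N x \<xi>)"
proof -
  have cc: "cis t + cis (- t) = of_real (2 * cos t)" for t
    by (simp add: complex_eq_iff)
  have "\<psi> c x (\<xi>(l := \<xi> l + 1)) + \<psi> c x (\<xi>(l := \<xi> l - 1)) = 2 * of_real (cos (x l)) * \<psi> c x \<xi>" if "l < N" for l
  proof -
    have "\<psi> c x (\<xi>(l := \<xi> l + 1)) = cis (x l) * \<psi> c x \<xi>"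
      using plane_upd[OF that, of x \<xi> 1] that by (simp add: \<psi>_def)
    moreover have "\<psi> c x (\<xi>(l := \<xi> l - 1)) = cis (- x l) * \<psi> c x \<xi>"
      using plane_upd[OF that, of x \<xi> "-1"] that by (simp add: \<psi>_def)
    ultimately show ?thesis
      using cc[of "x l"] by (metis distrib_right of_real_mult of_real_numeral)
  qed
  then have "(\<Sum>l<N. \<psi> c x (\<xi>(l := \<xi> l + 1)) + \<psi> c x (\<xi>(l := \<xi> l - 1)))
      = 2 * of_real (\<Sum>l<N. cos (x l)) * \<psi> c x \<xi>"
    by (simp add: sum_distrib_left sum_distrib_right)
  then show ?thesis
    by (simp add: disc_lap_neg_def symb_def \<psi>_def field_simps)
qed

lemma disc_lap_neg_sum: "disc_lap_neg n (\<lambda>\<xi>. \<Sum>y\<in>Y. g y \<xi>) \<xi> = (\<Sum>y\<in>Y. disc_lap_neg n (g y) \<xi>)"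
proof -
  have "(\<Sum>l<n. (\<Sum>y\<in>Y. g y (\<xi>(l := \<xi> l + 1))) + (\<Sum>y\<in>Y. g y (\<xi>(l := \<xi> l - 1))))
      = (\<Sum>y\<in>Y. \<Sum>l<n. g y (\<xi>(l := \<xi> l + 1)) + g y (\<xi>(l := \<xi> l - 1)))"
    unfolding sum.distrib[symmetric] by (rule sum.swap)
  then show ?thesis
    unfolding disc_lap_neg_def sum_subtractf by (simp add: sum_distrib_left)
qed

lemma disc_lap_neg_modes:
  fixes N :: nat and c :: "'y \<Rightarrow> int \<Rightarrow> complex" and x :: "'y \<Rightarrow> nat \<Rightarrow> real" and Y :: "'y set"
  defines "\<Psi> \<equiv> \<lambda>\<xi>. \<Sum>y\<in>Y. c y (\<xi> N) * plane N (x y) \<xi>"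
  shows "disc_lap_neg (Suc N) \<Psi> \<xi> - of_real lam * \<Psi> \<xi>
       = - (1/4) * (\<Sum>y\<in>Y. (c y (\<xi> N + 1) + c y (\<xi> N - 1) - 2 * of_real (symb N lam (x y)) * c y (\<xi> N)) * plane N (x y) \<xi>)"
  unfolding \<Psi>_def disc_lap_neg_sum sum_distrib_left sum_subtractf[symmetric]
  by (rule sum.cong[OF refl]) (simp only: disc_lap_neg_mode)

text \<open>On each slice Bessel's equality gives L^N times at most L^N W^2, and the normalization
  divides by L^(2N). The bound \<open>2 * k + 5 \<le> L\<close> makes each slice fit into one
  period.\<close>

lemma sum_lat_ball_modes_le:
  fixes c :: "(nat \<Rightarrow> int) \<Rightarrow> int \<Rightarrow> complex" and k L N :: nat and p :: "nat \<Rightarrow> real"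
  fixes Y :: "(nat \<Rightarrow> int) set"
  assumes L: "2 * k + 5 \<le> L" and Y: "Y \<subseteq> box_lat N {0..<int L}" and k: "k > 0"
    and W: "\<And>y m. y \<in> Y \<Longrightarrow> cmod (c y m) \<le> W" and W0: "0 \<le> W"
  defines "\<Psi> \<equiv> \<lambda>\<xi>. (\<Sum>y\<in>Y. c y (\<xi> N) * plane N (grid p L y) \<xi>) / of_nat (L ^ N)"
  shows "(\<Sum>\<xi>\<in>lat_ball (Suc N) (real k + 2). (cmod (\<Psi> \<xi>))\<^sup>2) \<le> 7 * W\<^sup>2 * k"
    and "cmod (\<Psi> \<xi>) \<le> W"
proof -
  let ?I = "{- int (k + 2)..int (k + 2)}" and ?J = "{- int (k + 2)..<- int (k + 2) + int L}"
  have L0: "L > 0" using L by simp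
  have cY: "real (card Y) \<le> L ^ N"
    using card_mono[OF finite_box_lat Y] by (simp add: card_box_lat flip: of_nat_power)
  have row: "(\<Sum>\<eta>\<in>box_lat N ?I. (cmod (\<Psi> (\<eta>(N := j))))\<^sup>2) \<le> W\<^sup>2" for j
  proof -
    have "(\<Sum>\<eta>\<in>box_lat N ?I. (cmod (\<Psi> (\<eta>(N := j))))\<^sup>2)
        \<le> (\<Sum>\<eta>\<in>box_lat N ?J. (cmod (\<Psi> (\<eta>(N := j))))\<^sup>2)"
      using L by (intro sum_mono2 finite_box_lat) (auto simp: box_lat_def)
    also have "\<dots> = (\<Sum>\<eta>\<in>box_lat N ?J. (cmod (\<Sum>y\<in>Y. c y j * plane N (grid p L y) \<eta>))\<^sup>2) / (L ^ N)\<^sup>2"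
      unfolding sum_divide_distrib
      by (rule sum.cong) (simp_all add: \<Psi>_def norm_divide power_divide norm_power)
    also have "\<dots> = L ^ N * (\<Sum>y\<in>Y. (cmod (c y j))\<^sup>2) / (L ^ N)\<^sup>2"
      by (simp add: bessel[OF L0 Y])
    also have "\<dots> = (\<Sum>y\<in>Y. (cmod (c y j))\<^sup>2) / L ^ N"
      using L0 by (simp add: power2_eq_square)
    also have "\<dots> \<le> (real (card Y) * W\<^sup>2) / L ^ N"
      by (intro divide_right_mono sum_bounded_above power_mono W) auto
    also have "\<dots> \<le> (real (L ^ N) * W\<^sup>2) / L ^ N"
      using cY by (intro divide_right_mono mult_right_mono) auto
    also have "\<dots> = W\<^sup>2" using L0 by simp
    finally show ?thesis .
  qed
  have "lat_ball (Suc N) (real k + 2) \<subseteq> box_lat (Suc N) ?I"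
    using lat_ball_subset_box[of "Suc N" "real k + 2"] by (simp add: add_ac)
  then have "(\<Sum>\<xi>\<in>lat_ball (Suc N) (real k + 2). (cmod (\<Psi> \<xi>))\<^sup>2) \<le> (\<Sum>\<xi>\<in>box_lat (Suc N) ?I. (cmod (\<Psi> \<xi>))\<^sup>2)"
    by (intro sum_mono2 finite_box_lat) auto
  also have "\<dots> = (\<Sum>j\<in>?I. \<Sum>\<eta>\<in>box_lat N ?I. (cmod (\<Psi> (\<eta>(N := j))))\<^sup>2)"
    unfolding sum_box_lat_Suc by (rule sum.swap)
  also have "\<dots> \<le> real (card ?I) * W\<^sup>2"
    by (intro sum_bounded_above row)
  \<comment> \<open>There are \<open>2 * k + 5\<close> slices, at most \<open>7 * k\<close> because
    \<open>k \<ge> 1\<close>.\<close>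
  also have "\<dots> \<le> (7 * k) * W\<^sup>2"
    using k by (intro mult_right_mono) auto
  finally show "(\<Sum>\<xi>\<in>lat_ball (Suc N) (real k + 2). (cmod (\<Psi> \<xi>))\<^sup>2) \<le> 7 * W\<^sup>2 * k" by (simp add: mult_ac)
  show "cmod (\<Psi> \<xi>) \<le> W"
  proof -
    have "cmod (\<Psi> \<xi>) = cmod (\<Sum>y\<in>Y. c y (\<xi> N) * plane N (grid p L y) \<xi>) / L ^ N"
      by (simp add: \<Psi>_def norm_divide norm_power)
    also have "\<dots> \<le> real (card Y) * W / L ^ N"
      by (intro divide_right_mono sum_norm_bound) (auto simp: norm_mult W)
    also have "\<dots> \<le> (L ^ N) * W / L ^ N"
      using cY W0 by (intro divide_right_mono mult_right_mono) auto
    also have "\<dots> = W" using L0 by simp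
    finally show ?thesis .
  qed
qed

lemma lat_norm_le_l1: "lat_norm n \<xi> \<le> l1 n \<xi>"
  unfolding lat_norm_L2_set l1_def by (rule L2_set_le_sum_abs)

lemma l1_nonneg: "0 \<le> l1 n \<xi>"
  by (simp add: l1_def sum_nonneg)

section \<open>Standing assumptions, and the pairing of the equation with test functions\<close>

locale rellich =
  fixes N :: nat and u f :: "(nat \<Rightarrow> int) \<Rightarrow> complex" and lam :: real
  assumes mean_decay: "((\<lambda>R. (1/R) * (\<Sum>\<xi>\<in>lat_ball (Suc N) R. (cmod (u \<xi>))\<^sup>2)) \<longlongrightarrow> 0) at_top"
    and f_decay: "\<And>\<gamma>. \<gamma> > 0 \<Longrightarrow>
      (\<lambda>\<xi>. (exp (\<gamma> * japanese (Suc N) \<xi>) * cmod (f \<xi>))\<^sup>2) summable_on lattice (Suc N)"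
    and f_cone: "\<And>\<xi>. \<xi> \<in> cone (Suc N) \<Longrightarrow> f \<xi> = 0"
    and lam: "0 < lam" "lam < real (Suc N)"
    and equation: "\<And>\<xi>. \<xi> \<in> lattice (Suc N) \<Longrightarrow>
      disc_lap_neg (Suc N) u \<xi> - of_real lam * u \<xi> = f \<xi>"
begin

text \<open>Each term of the convergent sum of squares is bounded by the sum, so \<open>f\<close>
  decays pointwise at every exponential rate. As \<open>l1\<close> is at most N + 1 times the
  bracket, the \<open>+ 1\<close> in \<open>\<Gamma>\<close> leaves a spare summable factor
  \<open>exp (- l1 (Suc N) \<xi>)\<close>.\<close>

lemma f_summable:
  assumes "\<gamma> \<ge> 0"
  shows "(\<lambda>\<xi>. exp (\<gamma> * l1 (Suc N) \<xi>) * cmod (f \<xi>)) summable_on lattice (Suc N)"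
proof -
  define \<Gamma> where "\<Gamma> = (\<gamma> + 1) * real (Suc N)"
  let ?g = "\<lambda>\<xi>. exp (\<Gamma> * japanese (Suc N) \<xi>) * cmod (f \<xi>)"
  have "\<Gamma> > 0" using assms by (simp add: \<Gamma>_def)
  define S where "S = (\<Sum>\<^sub>\<infinity>\<xi>\<in>lattice (Suc N). (?g \<xi>)\<^sup>2)"
  have "(?g \<xi>)\<^sup>2 \<le> S" if "\<xi> \<in> lattice (Suc N)" for \<xi>
    using finite_sum_le_infsum[OF f_decay[OF \<open>\<Gamma> > 0\<close>], of "{\<xi>}"] that by (simp add: S_def)
  then have gS: "?g \<xi> \<le> sqrt S" if "\<xi> \<in> lattice (Suc N)" for \<xi>
    using real_le_rsqrt that by blast
  have "exp (\<gamma> * l1 (Suc N) \<xi>) * cmod (f \<xi>) \<le> sqrt S * exp (- l1 (Suc N) \<xi>)" if \<xi>: "\<xi> \<in> lattice (Suc N)" for \<xi>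
  proof -
    have "l1 (Suc N) \<xi> \<le> real (card {..<Suc N}) * japanese (Suc N) \<xi>"
      unfolding l1_def
    proof (rule sum_bounded_above)
      fix l assume "l \<in> {..<Suc N}"
      then have "\<bar>real_of_int (\<xi> l)\<bar> \<le> lat_norm (Suc N) \<xi>" by (intro abs_le_lat_norm) simp
      also have "\<dots> \<le> japanese (Suc N) \<xi>"
        unfolding japanese_def by (rule real_le_rsqrt) simp
      finally show "\<bar>real_of_int (\<xi> l)\<bar> \<le> japanese (Suc N) \<xi>" .
    qed
    then have "(\<gamma> + 1) * l1 (Suc N) \<xi> \<le> \<Gamma> * japanese (Suc N) \<xi>"
      using assms unfolding \<Gamma>_def mult.assoc by (intro mult_left_mono) auto
    then have "exp (\<gamma> * l1 (Suc N) \<xi>) \<le> exp (\<Gamma> * japanese (Suc N) \<xi>) * exp (- l1 (Suc N) \<xi>)"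
      by (simp add: algebra_simps flip: exp_add)
    then have "exp (\<gamma> * l1 (Suc N) \<xi>) * cmod (f \<xi>) \<le> ?g \<xi> * exp (- l1 (Suc N) \<xi>)"
      using mult_right_mono[of _ _ "cmod (f \<xi>)"] by (fastforce simp: mult_ac)
    also have "\<dots> \<le> sqrt S * exp (- l1 (Suc N) \<xi>)"
      by (rule mult_right_mono[OF gS[OF \<xi>]]) simp
    finally show ?thesis .
  qed
  then show ?thesis
    by (intro summable_on_comparison_test[OF summable_on_cmult_right[OF summable_on_exp_l1]]) auto
qed

lemma f_mult_summable:
  fixes g :: "(nat \<Rightarrow> int) \<Rightarrow> complex"
  assumes "\<gamma> \<ge> 0" "\<And>\<xi>. \<xi> \<in> lattice (Suc N) \<Longrightarrow> cmod (g \<xi>) \<le> C * exp (\<gamma> * l1 (Suc N) \<xi>)"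
  shows "(\<lambda>\<xi>. cmod (f \<xi> * g \<xi>)) summable_on lattice (Suc N)"
    and "(\<lambda>\<xi>. f \<xi> * g \<xi>) summable_on lattice (Suc N)"
proof -
  show "(\<lambda>\<xi>. cmod (f \<xi> * g \<xi>)) summable_on lattice (Suc N)"
  proof (rule summable_on_comparison_test[OF summable_on_cmult_right[OF f_summable[OF assms(1)]]])
    fix \<xi> assume "\<xi> \<in> lattice (Suc N)"
    from mult_left_mono[OF assms(2)[OF this], of "cmod (f \<xi>)"]
    show "cmod (f \<xi> * g \<xi>) \<le> C * (exp (\<gamma> * l1 (Suc N) \<xi>) * cmod (f \<xi>))"
      by (simp add: norm_mult mult_ac)
  qed simp
  then show "(\<lambda>\<xi>. f \<xi> * g \<xi>) summable_on lattice (Suc N)"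
    by (rule abs_summable_summable)
qed

lemma f_bounded_summable:
  fixes g :: "(nat \<Rightarrow> int) \<Rightarrow> complex"
  assumes "\<And>\<xi>. \<xi> \<in> lattice (Suc N) \<Longrightarrow> cmod (g \<xi>) \<le> C"
  shows "(\<lambda>\<xi>. f \<xi> * g \<xi>) summable_on lattice (Suc N)"
  using f_mult_summable(2)[of 0 g C] assms by simp

text \<open>The squared mass of \<open>u\<close> in radius k + 1 is o(k) and that of
  \<open>\<Psi> k\<close> is O(k). The product of their square roots is o(k), and the commutator
  bound has a factor 1/k.\<close>

lemma commutator_tendsto_0:
  fixes \<Psi> :: "nat \<Rightarrow> (nat \<Rightarrow> int) \<Rightarrow> complex"
  assumes B: "\<And>k. k > 0 \<Longrightarrow> (\<Sum>\<xi>\<in>lat_ball (Suc N) (real k + 2). (cmod (\<Psi> k \<xi>))\<^sup>2) \<le> B * k"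
  shows "(\<lambda>k. (\<Sum>\<xi>\<in>lat_ball (Suc N) (real k + 1). u \<xi> * cutoff (Suc N) k \<xi> * (disc_lap_neg (Suc N) (\<Psi> k) \<xi> - of_real lam * \<Psi> k \<xi>))
            - (\<Sum>\<xi>\<in>lat_ball (Suc N) (real k + 1). f \<xi> * cutoff (Suc N) k \<xi> * \<Psi> k \<xi>)) \<longlonglongrightarrow> 0"
    (is "?D \<longlonglongrightarrow> 0")
proof (rule Lim_null_comparison)
  let ?n = "real (Suc N)"
  let ?U = "\<lambda>R. \<Sum>\<xi>\<in>lat_ball (Suc N) R. (cmod (u \<xi>))\<^sup>2"
  let ?E = "\<lambda>k::nat. ?n / 2 * sqrt (B * ((real k + 1) / k * (1 / (real k + 1) * ?U (real k + 1))))"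
  show "eventually (\<lambda>k. norm (?D k) \<le> ?E k) sequentially"
    using eventually_gt_at_top[of 0]
  proof eventually_elim
    case (elim k)
    have "(\<Sum>\<xi>\<in>lat_ball (Suc N) (real k + 1). f \<xi> * cutoff (Suc N) k \<xi> * \<Psi> k \<xi>)
        = (\<Sum>\<xi>\<in>lat_ball (Suc N) (real k + 1). (disc_lap_neg (Suc N) u \<xi> - of_real lam * u \<xi>) * cutoff (Suc N) k \<xi> * \<Psi> k \<xi>)"
      by (rule sum.cong) (auto simp: lat_ball_def equation)
    then have "norm (?D k) \<le> ?n / (2 * k) * (sqrt (?U (real k + 1)) * sqrt (\<Sum>\<xi>\<in>lat_ball (Suc N) (real k + 2). (cmod (\<Psi> k \<xi>))\<^sup>2))"
      using commutator_bound[where s = "real k" and n = "Suc N" and u = u and \<Psi> = "\<Psi> k" and lam = lam] elim 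
      by simp
    also have "\<dots> \<le> ?n / (2 * k) * (sqrt (?U (real k + 1)) * sqrt (B * k))"
      using B[OF elim] by (intro mult_left_mono real_sqrt_le_mono) (auto simp: sum_nonneg)
    also have "\<dots> = ?n / 2 * (sqrt (?U (real k + 1) * (B * k)) / sqrt (k\<^sup>2))"
      by (simp add: real_sqrt_mult)
    also have "\<dots> = ?n / 2 * sqrt (?U (real k + 1) * (B * k) / k\<^sup>2)"
      by (simp only: real_sqrt_divide)
    \<comment> \<open>Written so that the mean of \<open>u\<close> at radius k + 1 appears as a
      factor.\<close>
    also have "?U (real k + 1) * (B * k) / k\<^sup>2 = B * ((real k + 1) / k * (1 / (real k + 1) * ?U (real k + 1)))"
    proof -
      have "?U (real k + 1) * (B * k) / k\<^sup>2 = B * (?U (real k + 1) / k)"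
        using elim by (simp add: power2_eq_square)
      moreover have "(real k + 1) / k * (1 / (real k + 1) * X) = X / k" for X
        by simp
      ultimately show ?thesis by simp
    qed
    finally show ?case .
  qed
  have "(\<lambda>k::nat. 1 / (real k + 1) * ?U (real k + 1)) \<longlonglongrightarrow> 0"
    by (rule filterlim_compose[OF mean_decay]) real_asymp
  moreover have "(\<lambda>k::nat. (real k + 1) / k) \<longlonglongrightarrow> 1" by real_asymp
  ultimately have "(\<lambda>k. ?E k) \<longlonglongrightarrow> ?n / 2 * sqrt (B * (1 * 0))"
    by (intro tendsto_intros) (auto simp: add_ac)
  then show "?E \<longlonglongrightarrow> 0" by simp
qed

text \<open>The cutoff differs from 1 by at most |xi| / k, and the decay of \<open>f\<close> absorbs
  the factor |xi|.\<close>

lemma cutoff_source_tendsto_0: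
  fixes \<Psi> :: "nat \<Rightarrow> (nat \<Rightarrow> int) \<Rightarrow> complex"
  assumes W: "\<And>k \<xi>. k > 0 \<Longrightarrow> cmod (\<Psi> k \<xi>) \<le> W"
  shows "(\<lambda>k. (\<Sum>\<xi>\<in>lat_ball (Suc N) (real k + 1). f \<xi> * cutoff (Suc N) k \<xi> * \<Psi> k \<xi>)
            - (\<Sum>\<^sub>\<infinity>\<xi>\<in>lattice (Suc N). f \<xi> * \<Psi> k \<xi>)) \<longlonglongrightarrow> 0"
    (is "?D \<longlonglongrightarrow> 0")
proof (rule Lim_null_comparison)
  let ?F = "\<Sum>\<^sub>\<infinity>\<xi>\<in>lattice (Suc N). exp (1 * l1 (Suc N) \<xi>) * cmod (f \<xi>)"
  show "eventually (\<lambda>k. norm (?D k) \<le> W * ?F / k) sequentially"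
    using eventually_gt_at_top[of 0]
  proof eventually_elim
    case (elim k)
    let ?c = "cutoff (Suc N) (real k)"
    have W0: "0 \<le> W" using W[OF elim] norm_ge_zero order_trans by blast
    have sm: "(\<lambda>\<xi>. f \<xi> * \<Psi> k \<xi>) summable_on lattice (Suc N)"
      using f_bounded_summable W[OF elim] by blast
    have bc: "cmod (?c \<xi> * \<Psi> k \<xi>) \<le> 1 * W" for \<xi>
      unfolding norm_mult using elim by (intro mult_mono W) (auto simp: cutoff_nonneg cutoff_le_1)
    have smc: "(\<lambda>\<xi>. f \<xi> * (?c \<xi> * \<Psi> k \<xi>)) summable_on lattice (Suc N)"
      by (rule f_bounded_summable[OF bc])
    have fin: "(\<Sum>\<xi>\<in>lat_ball (Suc N) (real k + 1). f \<xi> * ?c \<xi> * \<Psi> k \<xi>) = (\<Sum>\<^sub>\<infinity>\<xi>\<in>lattice (Suc N). f \<xi> * (?c \<xi> * \<Psi> k \<xi>))"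
    proof -
      have "(\<Sum>\<^sub>\<infinity>\<xi>\<in>lattice (Suc N). f \<xi> * (?c \<xi> * \<Psi> k \<xi>)) = (\<Sum>\<^sub>\<infinity>\<xi>\<in>lat_ball (Suc N) (real k + 1). f \<xi> * (?c \<xi> * \<Psi> k \<xi>))"
        by (rule infsum_cong_neutral) (use elim in \<open>auto simp: lat_ball_def cutoff_eq_0\<close>)
      then show ?thesis by (simp add: finite_lat_ball mult.assoc)
    qed
    have pt: "cmod ((?c \<xi> - 1) * \<Psi> k \<xi>) \<le> W / k * exp (1 * l1 (Suc N) \<xi>)" for \<xi>
    proof -
      have "cmod (of_real (?c \<xi>) - 1) = \<bar>?c \<xi> - 1\<bar>"
        by (metis norm_of_real of_real_1 of_real_diff)
      also have "\<dots> \<le> lat_norm (Suc N) \<xi> / k"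
        using elim lat_norm_nonneg[of "Suc N" \<xi>] by (auto simp: cutoff_def max_def field_simps)
      also have "lat_norm (Suc N) \<xi> \<le> exp (1 * l1 (Suc N) \<xi>)"
        using lat_norm_le_l1[of "Suc N" \<xi>] exp_ge_add_one_self[of "l1 (Suc N) \<xi>"]
        by (simp only: mult_1)
      finally have "cmod (of_real (?c \<xi>) - 1) \<le> exp (1 * l1 (Suc N) \<xi>) / k"
        by (simp add: divide_right_mono)
      then have "cmod (of_real (?c \<xi>) - 1) * cmod (\<Psi> k \<xi>) \<le> exp (1 * l1 (Suc N) \<xi>) / k * W"
        by (intro mult_mono W elim) auto
      then show ?thesis by (simp add: norm_mult mult_ac)
    qed
    note abs = f_mult_summable(1)[of 1, OF _ pt] and smd = f_mult_summable(2)[of 1, OF _ pt]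
    have "(\<Sum>\<^sub>\<infinity>\<xi>\<in>lattice (Suc N). f \<xi> * (?c \<xi> * \<Psi> k \<xi>))
        = (\<Sum>\<^sub>\<infinity>\<xi>\<in>lattice (Suc N). f \<xi> * ((?c \<xi> - 1) * \<Psi> k \<xi>) + f \<xi> * \<Psi> k \<xi>)"
      by (rule infsum_cong) (simp add: algebra_simps)
    also have "\<dots> = (\<Sum>\<^sub>\<infinity>\<xi>\<in>lattice (Suc N). f \<xi> * ((?c \<xi> - 1) * \<Psi> k \<xi>)) + (\<Sum>\<^sub>\<infinity>\<xi>\<in>lattice (Suc N). f \<xi> * \<Psi> k \<xi>)"
      by (rule infsum_add[OF smd sm]) simp
    finally have D: "?D k = (\<Sum>\<^sub>\<infinity>\<xi>\<in>lattice (Suc N). f \<xi> * ((?c \<xi> - 1) * \<Psi> k \<xi>))"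
      unfolding fin by simp
    have "norm (?D k) \<le> (\<Sum>\<^sub>\<infinity>\<xi>\<in>lattice (Suc N). cmod (f \<xi> * ((?c \<xi> - 1) * \<Psi> k \<xi>)))"
      unfolding D by (rule norm_infsum_bound) (use abs in simp)
    also have "\<dots> \<le> (\<Sum>\<^sub>\<infinity>\<xi>\<in>lattice (Suc N). W / k * (exp (1 * l1 (Suc N) \<xi>) * cmod (f \<xi>)))"
    proof (rule infsum_mono)
      fix \<xi>
      from mult_left_mono[OF pt, of "cmod (f \<xi>)"]
      show "cmod (f \<xi> * ((?c \<xi> - 1) * \<Psi> k \<xi>)) \<le> W / k * (exp (1 * l1 (Suc N) \<xi>) * cmod (f \<xi>))"
        by (simp add: norm_mult mult_ac)
    next
      show "(\<lambda>\<xi>. W / k * (exp (1 * l1 (Suc N) \<xi>) * cmod (f \<xi>))) summable_on lattice (Suc N)"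
        by (rule summable_on_cmult_right[OF f_summable]) simp
    qed (use abs in simp)
    also have "\<dots> = W / k * ?F"
      by (rule infsum_cmult_right')
    finally show ?case by simp
  qed
  show "(\<lambda>k. W * ?F / real k) \<longlonglongrightarrow> 0" by (rule lim_const_over_n)
qed

text \<open>The form in which the hypothesis on \<open>u\<close> is used: uniformly bounded weights
  suffice. Period, index set and weights may vary with \<open>k\<close>, since the period has to
  exceed the diameter of the truncation.\<close>

lemma test_modes:
  fixes c :: "nat \<Rightarrow> (nat \<Rightarrow> int) \<Rightarrow> int \<Rightarrow> complex" and L :: "nat \<Rightarrow> nat" and p :: "nat \<Rightarrow> real"
  fixes Y :: "nat \<Rightarrow> (nat \<Rightarrow> int) set"
  assumes L: "\<And>k. 2 * k + 5 \<le> L k" and Y: "\<And>k. Y k \<subseteq> box_lat N {0..<int (L k)}"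
    and W: "\<And>k y m. y \<in> Y k \<Longrightarrow> cmod (c k y m) \<le> W" and W0: "0 \<le> W"
  defines "\<Psi> \<equiv> \<lambda>k \<xi>. (\<Sum>y\<in>Y k. c k y (\<xi> N) * plane N (grid p (L k) y) \<xi>) / of_nat (L k ^ N)"
  shows "(\<lambda>k. (\<Sum>\<xi>\<in>lat_ball (Suc N) (real k + 1). u \<xi> * cutoff (Suc N) k \<xi> * (disc_lap_neg (Suc N) (\<Psi> k) \<xi> - of_real lam * \<Psi> k \<xi>))
            - (\<Sum>\<^sub>\<infinity>\<xi>\<in>lattice (Suc N). f \<xi> * \<Psi> k \<xi>)) \<longlonglongrightarrow> 0"
proof -
  have "(\<Sum>\<xi>\<in>lat_ball (Suc N) (real k + 2). (cmod (\<Psi> k \<xi>))\<^sup>2) \<le> 7 * W\<^sup>2 * k" if "k > 0" for k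
    unfolding \<Psi>_def by (rule sum_lat_ball_modes_le(1)[OF L Y that W W0])
  note lim = commutator_tendsto_0[OF this]
  have "cmod (\<Psi> k \<xi>) \<le> W" if "k > 0" for k \<xi>
    unfolding \<Psi>_def by (rule sum_lat_ball_modes_le(2)[OF L Y that W W0])
  from tendsto_add[OF lim cutoff_source_tendsto_0[where \<Psi> = \<Psi> and W = W, OF this]]
  show ?thesis by simp
qed

end

section \<open>The Fourier transform of the source on the real characteristic set\<close>

lemma infsum_sum_finite:
  fixes g :: "'y \<Rightarrow> 'a \<Rightarrow> complex"
  assumes "finite Y" "\<And>y. y \<in> Y \<Longrightarrow> g y summable_on A"
  shows "(\<Sum>\<^sub>\<infinity>\<xi>\<in>A. \<Sum>y\<in>Y. g y \<xi>) = (\<Sum>y\<in>Y. \<Sum>\<^sub>\<infinity>\<xi>\<in>A. g y \<xi>)"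
proof -
  have "((\<lambda>\<xi>. \<Sum>y\<in>Y. g y \<xi>) has_sum (\<Sum>y\<in>Y. infsum (g y) A)) A"
    using assms by (induction Y) (auto intro!: has_sum_add has_sum_infsum)
  then show ?thesis by (rule infsumI)
qed

text \<open>A chord is not longer than its arc: |e^{ir} - 1| = 2 |sin (r/2)|.\<close>

lemma norm_cis_diff_le: "cmod (cis s - cis t) \<le> \<bar>s - t\<bar>"
proof -
  have "cis s - cis t = cis t * (cis (s - t) - 1)"
    by (simp add: right_diff_distrib cis_mult)
  then have "cmod (cis s - cis t) = cmod (cis (s - t) - 1)"
    by (simp add: norm_mult)
  also have "(cmod (cis r - 1))\<^sup>2 \<le> r\<^sup>2" for r
  proof -
    have "(cmod (cis r - 1))\<^sup>2 = (cos r - 1)\<^sup>2 + (sin r)\<^sup>2"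
      by (simp add: cmod_power2)
    also have "\<dots> = 2 - 2 * cos r"
      using sin_cos_squared_add[of r] by (simp add: power2_eq_square algebra_simps)
    also have "\<dots> = (2 * \<bar>sin (r / 2)\<bar>)\<^sup>2"
      using cos_double_sin[of "r / 2"] by (simp add: power_mult_distrib)
    also have "\<dots> \<le> \<bar>r\<bar>\<^sup>2"
      using abs_sin_x_le_abs_x[of "r / 2"] by (intro power_mono) auto
    finally show ?thesis by simp
  qed
  from this[of "s - t"] have "cmod (cis (s - t) - 1) \<le> \<bar>s - t\<bar>"
    by (simp add: abs_le_square_iff[symmetric])
  finally show ?thesis .
qed

lemma norm_plane_diff_le:
  assumes "\<And>l. l < N \<Longrightarrow> \<bar>x l - y l\<bar> \<le> d"
  shows "cmod (plane N x \<xi> - plane N y \<xi>) \<le> d * l1 N \<xi>"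
proof -
  have "cmod (plane N x \<xi> - plane N y \<xi>) \<le> \<bar>\<Sum>l<N. (x l - y l) * \<xi> l\<bar>"
    unfolding plane_def using norm_cis_diff_le[of "\<Sum>l<N. x l * \<xi> l" "\<Sum>l<N. y l * \<xi> l"]
    by (simp add: sum_subtractf left_diff_distrib)
  also have "\<dots> \<le> (\<Sum>l<N. d * \<bar>real_of_int (\<xi> l)\<bar>)"
    by (rule order_trans[OF sum_abs]) (auto intro!: sum_mono mult_right_mono assms simp: abs_mult)
  finally show ?thesis by (simp add: l1_def sum_distrib_left)
qed

lemma symb_lipschitz:
  assumes "\<And>l. l < N \<Longrightarrow> \<bar>x l - y l\<bar> \<le> d"
  shows "\<bar>symb N lam x - symb N lam y\<bar> \<le> N * d"
proof -
  have c: "\<bar>cos s - cos t\<bar> \<le> \<bar>s - t\<bar>" for s t :: real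
    using abs_Re_le_cmod[of "cis s - cis t"] norm_cis_diff_le[of s t] by simp
  have "\<bar>symb N lam x - symb N lam y\<bar> = \<bar>\<Sum>l<N. cos (y l) - cos (x l)\<bar>"
    by (simp add: symb_def sum_subtractf)
  also have "\<dots> \<le> (\<Sum>l<N. d)"
    by (rule order_trans[OF sum_abs], rule sum_mono) (metis c assms lessThan_iff abs_minus_commute order_trans)
  finally show ?thesis by simp
qed

lemma plane_Suc: "plane (Suc N) (x(N := t)) \<xi> = cis (\<xi> N * t) * plane N x \<xi>"
proof -
  have "(\<Sum>l<N. (x(N := t)) l * \<xi> l) = (\<Sum>l<N. x l * \<xi> l)" by (rule sum.cong) auto
  then show ?thesis by (simp add: plane_def cis_mult algebra_simps)
qed

context rellich
begin

text \<open>The sign in e^{+i x.xi} is chosen so that pairing \<open>f\<close> with a mode gives a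
  value of \<open>fhat\<close>.\<close>

definition fhat :: "(nat \<Rightarrow> real) \<Rightarrow> complex" where
  "fhat x = (\<Sum>\<^sub>\<infinity>\<xi>\<in>lattice (Suc N). f \<xi> * plane (Suc N) x \<xi>)"

text \<open>A plane wave varies with x at rate \<open>l1 (Suc N) \<xi>\<close>, which
  \<open>exp (l1 (Suc N) \<xi>)\<close> dominates. The exponentially weighted sum of
  \<open>f\<close> is thus both a Lipschitz constant and a bound.\<close>

lemma fhat_lipschitz:
  obtains F where "F \<ge> 0" "\<And>x y (d :: real). (\<And>l. l < Suc N \<Longrightarrow> \<bar>x l - y l\<bar> \<le> d) \<Longrightarrow> cmod (fhat x - fhat y) \<le> F * d"
    and "\<And>x. cmod (fhat x) \<le> F"
proof -
  define F where "F = (\<Sum>\<^sub>\<infinity>\<xi>\<in>lattice (Suc N). exp (1 * l1 (Suc N) \<xi>) * cmod (f \<xi>))"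
  note sF = f_summable[of 1]
  have main: "cmod (\<Sum>\<^sub>\<infinity>\<xi>\<in>lattice (Suc N). f \<xi> * g \<xi>) \<le> F * d"
    if "\<And>\<xi>. cmod (g \<xi>) \<le> d * exp (1 * l1 (Suc N) \<xi>)" for g d
  proof -
    note abs = f_mult_summable(1)[of 1, OF _ that]
    have "cmod (\<Sum>\<^sub>\<infinity>\<xi>\<in>lattice (Suc N). f \<xi> * g \<xi>) \<le> (\<Sum>\<^sub>\<infinity>\<xi>\<in>lattice (Suc N). cmod (f \<xi> * g \<xi>))"
      by (rule norm_infsum_bound) (use abs in simp)
    also have "\<dots> \<le> (\<Sum>\<^sub>\<infinity>\<xi>\<in>lattice (Suc N). d * (exp (1 * l1 (Suc N) \<xi>) * cmod (f \<xi>)))"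
    proof (rule infsum_mono)
      fix \<xi>
      from mult_left_mono[OF that, of "cmod (f \<xi>)" \<xi>]
      show "cmod (f \<xi> * g \<xi>) \<le> d * (exp (1 * l1 (Suc N) \<xi>) * cmod (f \<xi>))"
        by (simp add: norm_mult mult_ac)
    next
      show "(\<lambda>\<xi>. d * (exp (1 * l1 (Suc N) \<xi>) * cmod (f \<xi>))) summable_on lattice (Suc N)"
        by (rule summable_on_cmult_right[OF sF]) simp
    qed (use abs in simp)
    also have "\<dots> = d * F" unfolding F_def by (rule infsum_cmult_right')
    finally show ?thesis by (simp add: mult.commute)
  qed
  show ?thesis
  proof
    show "F \<ge> 0" unfolding F_def by (rule infsum_nonneg) simp
    show "cmod (fhat x) \<le> F" for x
      unfolding fhat_def using main[of "plane (Suc N) x" 1] by (simp add: l1_nonneg)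
    fix x y and d :: real assume d: "\<And>l. l < Suc N \<Longrightarrow> \<bar>x l - y l\<bar> \<le> d"
    have d0: "d \<ge> 0" using d[of 0] by linarith
    have sm: "(\<lambda>\<xi>. f \<xi> * plane (Suc N) x \<xi>) summable_on lattice (Suc N)" for x
      by (rule f_bounded_summable[of _ 1]) simp
    have le: "cmod (plane (Suc N) x \<xi> - plane (Suc N) y \<xi>) \<le> d * exp (1 * l1 (Suc N) \<xi>)" for \<xi>
    proof -
      have "l1 (Suc N) \<xi> \<le> exp (1 * l1 (Suc N) \<xi>)"
        using exp_ge_add_one_self[of "l1 (Suc N) \<xi>"] by (simp only: mult_1)
      from mult_left_mono[OF this d0] norm_plane_diff_le[of "Suc N" x y d \<xi>, OF d]
      show ?thesis by linarith
    qed
    have "fhat x = (\<Sum>\<^sub>\<infinity>\<xi>\<in>lattice (Suc N). f \<xi> * (plane (Suc N) x \<xi> - plane (Suc N) y \<xi>) + f \<xi> * plane (Suc N) y \<xi>)"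
      unfolding fhat_def by (rule infsum_cong) (simp add: algebra_simps)
    also have "\<dots> = (\<Sum>\<^sub>\<infinity>\<xi>\<in>lattice (Suc N). f \<xi> * (plane (Suc N) x \<xi> - plane (Suc N) y \<xi>)) + fhat y"
      unfolding fhat_def by (rule infsum_add[OF f_mult_summable(2)[of 1, OF _ le] sm]) simp
    finally show "cmod (fhat x - fhat y) \<le> F * d" using main[OF le] by simp
  qed
qed

text \<open>The test function has weights conj(fhat) on a grid in a small cube with corner p, so that
  its pairing with f is the average of |fhat|^2 over the grid. The cube takes up the fixed
  fraction K^{-N} of the period, so this average stays away from 0 if fhat does not vanish.\<close>

lemma fhat_eq_0:
  assumes p: "\<bar>symb N lam p\<bar> < 1" and s: "s = 1 \<or> s = -1"
  shows "fhat (p(N := s * arccos (symb N lam p))) = 0"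
proof (rule ccontr)
  \<comment> \<open>Where |a(x)| \<le> 1, \<open>X\<close> lifts x to the characteristic set: the
    cosine of the last angle is a(x).\<close>
  define X where "X x = x(N := s * arccos (symb N lam x))" for x :: "nat \<Rightarrow> real"
  define D where "D x = fhat (X x)" for x
  assume "fhat (p(N := s * arccos (symb N lam p))) \<noteq> 0"
  then have Dp: "cmod (D p) > 0" by (simp add: D_def X_def)
  obtain F where F: "F \<ge> 0" "\<And>x y d. (\<And>l. l < Suc N \<Longrightarrow> \<bar>x l - y l\<bar> \<le> d) \<Longrightarrow> cmod (fhat x - fhat y) \<le> F * d"
    "\<And>x. cmod (fhat x) \<le> F" using fhat_lipschitz by blast
  \<comment> \<open>Makes \<open>F * e\<close> at most half of \<open>cmod (D p)\<close>;
    \<open>F + 1\<close> avoids a division by 0.\<close>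
  define e where "e = cmod (D p) / (2 * (F + 1))"
  have e: "e > 0" using Dp F(1) by (simp add: e_def)
  have "isCont arccos (symb N lam p)" using p by (intro isCont_arccos) auto
  then obtain d1 where d1: "d1 > 0" "\<And>a. \<bar>a - symb N lam p\<bar> < d1 \<Longrightarrow> \<bar>arccos a - arccos (symb N lam p)\<bar> < e"
    using e unfolding continuous_at_eps_delta by (auto simp: dist_real_def)
  \<comment> \<open>Where all |x_l - p_l| \<le> d, the first N angles move by at most
    \<open>e\<close>, and a(x) moves by at most N d. The latter is below \<open>d1\<close>, so that
    the arccosine moves by less than \<open>e\<close>, and below 1 - |a(p)|, so that |a(x)| <
    1.\<close>
  define d where "d = min e (min d1 (1 - \<bar>symb N lam p\<bar>) / (2 * (real N + 1)))"
  have d: "d > 0" using e d1(1) p by (simp add: d_def)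
  have dN: "N * d < d1" "N * d < 1 - \<bar>symb N lam p\<bar>"
  proof -
    have "(real N + 1) * d \<le> (real N + 1) * (min d1 (1 - \<bar>symb N lam p\<bar>) / (2 * (real N + 1)))"
      by (intro mult_left_mono) (simp_all add: d_def)
    also have "\<dots> = min d1 (1 - \<bar>symb N lam p\<bar>) / 2" by (simp add: field_simps)
    finally have "(real N + 1) * d \<le> min d1 (1 - \<bar>symb N lam p\<bar>) / 2" .
    then show "N * d < d1" "N * d < 1 - \<bar>symb N lam p\<bar>"
      using d d1(1) p by (auto simp: distrib_right min_def split: if_splits)
  qed
  have near: "\<bar>symb N lam x\<bar> < 1" "cmod (D x) \<ge> cmod (D p) / 2" if x: "\<And>l. l < N \<Longrightarrow> \<bar>x l - p l\<bar> \<le> d" for x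
  proof -
    have a: "\<bar>symb N lam x - symb N lam p\<bar> \<le> N * d" by (rule symb_lipschitz[OF x])
    then show "\<bar>symb N lam x\<bar> < 1" using dN(2) by linarith
    have "\<bar>X x l - X p l\<bar> \<le> e" if "l < Suc N" for l
    proof (cases "l = N")
      case True
      have "\<bar>arccos (symb N lam x) - arccos (symb N lam p)\<bar> < e" using a dN(1) by (intro d1(2)) linarith
      then show ?thesis using True s by (auto simp: X_def)
    next
      case False
      then show ?thesis using that x[of l] by (simp add: X_def d_def)
    qed
    then have "cmod (D x - D p) \<le> F * e" unfolding D_def by (rule F(2))
    also have "\<dots> \<le> (F + 1) * e" using e by (simp add: distrib_right)
    also have "\<dots> = cmod (D p) / 2" using F(1) by (simp add: e_def field_simps)
    finally show "cmod (D x) \<ge> cmod (D p) / 2"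
      using norm_triangle_ineq2[of "D p" "D p - D x"] by (simp add: norm_minus_commute)
  qed
  obtain K :: nat where K: "K > 0" "2 * pi / K \<le> d"
  proof -
    obtain K :: nat where "2 * pi / d < K" using reals_Archimedean2 by blast
    moreover have "2 * pi / d > 0" using d by simp
    ultimately have "0 < real K" "2 * pi \<le> d * K" using d by (simp_all only: order_less_trans) (simp add: field_simps)
    then show ?thesis using that[of K] by (simp add: field_simps)
  qed
  \<comment> \<open>Of the \<open>K * M k\<close> grid points per direction only the first
    \<open>M k\<close> are used. They stay within 2 pi / K of \<open>p\<close> and make up the
    fraction 1/K of the period for every \<open>k\<close>.\<close>
  define M where "M k = 2 * k + 5" for k :: nat
  define L where "L k = K * M k" for k
  define Y where "Y k = box_lat N {0..<int (M k)}" for k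
  have L: "2 * k + 5 \<le> L k" for k
    using K(1) by (simp add: L_def M_def)
  have YL: "Y k \<subseteq> box_lat N {0..<int (L k)}" for k
    using L[of k] by (fastforce simp: Y_def box_lat_def M_def)
  define x where "x k = grid p (L k)" for k
  have xd: "\<bar>x k y l - p l\<bar> \<le> d" if "y \<in> Y k" "l < N" for k y l
  proof -
    have y: "0 \<le> y l" "y l < int (M k)" using that by (auto simp: Y_def box_lat_def)
    then have "\<bar>x k y l - p l\<bar> = 2 * pi * y l / L k" by (simp add: x_def grid_def)
    also have "\<dots> \<le> 2 * pi * M k / L k" 
      using y by (intro divide_right_mono mult_left_mono) auto
    also have "\<dots> = 2 * pi / K" by (simp add: L_def M_def)
    finally show ?thesis using K(2) by simp
  qed
  \<comment> \<open>A real angle with cosine a(x), so that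
    \<open>cis (real_of_int m * th k y)\<close> is a bounded solution of the homogeneous
    recurrence.\<close>
  define th where "th k y = s * arccos (symb N lam (x k y))" for k y
  define c where "c k y m = cnj (D (x k y)) * cis (real_of_int m * th k y)" for k y m
  define \<Psi> where "\<Psi> k \<xi> = (\<Sum>y\<in>Y k. c k y (\<xi> N) * plane N (grid p (L k) y) \<xi>) / of_nat (L k ^ N)" for k \<xi>
  have fY: "finite (Y k)" for k by (simp add: Y_def finite_box_lat)
  have "disc_lap_neg (Suc N) (\<Psi> k) \<xi> - of_real lam * \<Psi> k \<xi> = 0" for k \<xi>
  proof -
    define q :: complex where "q = of_nat (L k ^ N)"
    have rec: "c k y (m + 1) / q + c k y (m - 1) / q - 2 * of_real (symb N lam (grid p (L k) y)) * (c k y m / q) = 0" if "y \<in> Y k" for y m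
    proof -
      have "\<bar>symb N lam (x k y)\<bar> < 1" using near(1) xd that by blast
      then have "symb N lam (x k y) = cos (th k y)" using s by (auto simp: th_def)
      then have "c k y (m + 1) + c k y (m - 1) - 2 * of_real (symb N lam (grid p (L k) y)) * c k y m = 0"
        by (simp add: c_def x_def[symmetric] complex_eq_iff algebra_simps cos_add cos_diff sin_add sin_diff)
      moreover have "c k y (m + 1) / q + c k y (m - 1) / q - 2 * of_real (symb N lam (grid p (L k) y)) * (c k y m / q)
          = (c k y (m + 1) + c k y (m - 1) - 2 * of_real (symb N lam (grid p (L k) y)) * c k y m) / q"
        by (simp add: add_divide_distrib diff_divide_distrib)
      ultimately show ?thesis by simp
    qed
    have eq: "\<Psi> k = (\<lambda>\<xi>. \<Sum>y\<in>Y k. (c k y (\<xi> N) / q) * plane N (grid p (L k) y) \<xi>)"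
      by (simp add: \<Psi>_def sum_divide_distrib fun_eq_iff q_def)
    show ?thesis
      unfolding eq disc_lap_neg_modes[where c = "\<lambda>y m. c k y m / q"] using rec by simp
  qed
  moreover have "(\<Sum>\<^sub>\<infinity>\<xi>\<in>lattice (Suc N). f \<xi> * \<Psi> k \<xi>) = of_real ((\<Sum>y\<in>Y k. (cmod (D (x k y)))\<^sup>2) / L k ^ N)" for k
  proof -
    have t: "f \<xi> * (c k y (\<xi> N) * plane N (grid p (L k) y) \<xi>) = cnj (D (x k y)) * (f \<xi> * plane (Suc N) (X (x k y)) \<xi>)" for \<xi> y
      by (simp add: c_def th_def X_def plane_Suc x_def mult_ac)
    have sm: "(\<lambda>\<xi>. f \<xi> * plane (Suc N) (X (x k y)) \<xi>) summable_on lattice (Suc N)" for y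
      by (rule f_bounded_summable[of _ 1]) simp
    have "(\<Sum>\<^sub>\<infinity>\<xi>\<in>lattice (Suc N). f \<xi> * \<Psi> k \<xi>)
        = (\<Sum>\<^sub>\<infinity>\<xi>\<in>lattice (Suc N). (\<Sum>y\<in>Y k. cnj (D (x k y)) * (f \<xi> * plane (Suc N) (X (x k y)) \<xi>)) * (1 / of_nat (L k ^ N)))"
      by (rule infsum_cong) (simp add: \<Psi>_def t[symmetric] sum_distrib_left)
    also have "\<dots> = (\<Sum>\<^sub>\<infinity>\<xi>\<in>lattice (Suc N). (\<Sum>y\<in>Y k. cnj (D (x k y)) * (f \<xi> * plane (Suc N) (X (x k y)) \<xi>))) * (1 / of_nat (L k ^ N))"
      by (rule infsum_cmult_left')
    also have "(\<Sum>\<^sub>\<infinity>\<xi>\<in>lattice (Suc N). (\<Sum>y\<in>Y k. cnj (D (x k y)) * (f \<xi> * plane (Suc N) (X (x k y)) \<xi>)))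
        = (\<Sum>y\<in>Y k. cnj (D (x k y)) * D (x k y))"
      unfolding D_def fhat_def infsum_cmult_right'[symmetric]
      by (rule infsum_sum_finite[OF fY summable_on_cmult_right[OF sm]])
    also have "\<dots> = of_real (\<Sum>y\<in>Y k. (cmod (D (x k y)))\<^sup>2)"
      by (simp add: complex_norm_square mult.commute del: of_real_power)
    finally show ?thesis by simp
  qed
  moreover have "cmod (c k y m) \<le> F" for k y m
    using F(3) by (simp add: c_def norm_mult D_def)
  note test_modes[where c = c and L = L and Y = Y and W = F and p = p, OF L YL this F(1), folded \<Psi>_def]
  ultimately have "(\<lambda>k. - complex_of_real ((\<Sum>y\<in>Y k. (cmod (D (x k y)))\<^sup>2) / L k ^ N)) \<longlonglongrightarrow> 0"
    by simp
  then have lim: "(\<lambda>k. (\<Sum>y\<in>Y k. (cmod (D (x k y)))\<^sup>2) / L k ^ N) \<longlonglongrightarrow> 0"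
    unfolding tendsto_minus_cancel_left[symmetric] minus_zero
    using tendsto_of_real_iff[of _ 0] by fastforce
  \<comment> \<open>The quotient of \<open>card (Y k)\<close> by \<open>L k ^ N\<close> is
    \<open>1 / K ^ N\<close>, so the lower bound is independent of \<open>k\<close> and contradicts
    the limit 0.\<close>
  have "(cmod (D p) / 2)\<^sup>2 / K ^ N \<le> (\<Sum>y\<in>Y k. (cmod (D (x k y)))\<^sup>2) / L k ^ N" for k
  proof -
    have "real (card (Y k)) * (cmod (D p) / 2)\<^sup>2 \<le> (\<Sum>y\<in>Y k. (cmod (D (x k y)))\<^sup>2)"
      using near(2) xd by (intro sum_bounded_below power_mono) auto
    then have "real (M k) ^ N * (cmod (D p) / 2)\<^sup>2 / L k ^ N \<le> (\<Sum>y\<in>Y k. (cmod (D (x k y)))\<^sup>2) / L k ^ N"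
      by (intro divide_right_mono) (auto simp: Y_def card_box_lat)
    then show ?thesis by (simp add: L_def power_mult_distrib M_def)
  qed
  then have "(cmod (D p) / 2)\<^sup>2 / K ^ N \<le> 0"
    by (intro LIMSEQ_le_const[OF lim]) auto
  moreover have "(cmod (D p) / 2)\<^sup>2 / K ^ N > 0" using Dp K(1) by simp
  ultimately show False by simp
qed

end

section \<open>Chebyshev polynomials and analytic continuation\<close>

text \<open>Shifted second kind: cheb (Suc n) is U_n.\<close>

fun cheb :: "nat \<Rightarrow> complex \<Rightarrow> complex" where
  "cheb 0 a = 0"
| "cheb (Suc 0) a = 1"
| "cheb (Suc (Suc n)) a = 2 * a * cheb (Suc n) a - cheb n a"

text \<open>The odd extension to negative indices, which satisfies the three-term recurrence at all
  integers, also across 0.\<close>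

definition chebi :: "int \<Rightarrow> complex \<Rightarrow> complex" where
  "chebi j a = of_int (sgn j) * cheb (nat \<bar>j\<bar>) a"

lemma chebi_rec: "chebi (j + 1) a + chebi (j - 1) a = 2 * a * chebi j a"
proof -
  consider "j = 0" | n where "j = int (Suc n)" | n where "j = - int (Suc n)"
    by (metis int_cases not0_implies_Suc of_nat_0 zero_less_Suc int_cases2 nat.exhaust minus_zero)
  then show ?thesis
  proof cases
    case 1 then show ?thesis by (simp add: chebi_def)
  next
    case (2 n)
    then have "nat \<bar>j + 1\<bar> = Suc (Suc n)" "nat \<bar>j\<bar> = Suc n" "nat \<bar>j - 1\<bar> = n" "sgn (j + 1) = 1" "sgn j = 1"
      by auto
    moreover have "of_int (sgn (j - 1)) * cheb n a = cheb n a" using 2 by (cases n) auto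
    ultimately show ?thesis by (simp add: chebi_def)
  next
    case (3 n)
    then have "nat \<bar>j - 1\<bar> = Suc (Suc n)" "nat \<bar>j\<bar> = Suc n" "nat \<bar>j + 1\<bar> = n" "sgn (j - 1) = -1" "sgn j = -1"
      by auto
    moreover have "of_int (sgn (j + 1)) * cheb n a = - cheb n a" using 3 by (cases n) auto
    ultimately show ?thesis by (simp add: chebi_def)
  qed
qed

lemma recurrence_unique:
  fixes r :: "int \<Rightarrow> complex"
  assumes rec: "\<And>j. r (j + 1) + r (j - 1) = 2 * a * r j" and "r 0 = 0" "r 1 = 0"
  shows "r j = 0"
proof -
  have up: "r (int n) = 0 \<and> r (int n + 1) = 0" for n
  proof (induction n)
    case (Suc n)
    then show ?case using rec[of "int n + 1"] by (simp add: add_ac)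
  qed (use assms in auto)
  have down: "r (- int n) = 0 \<and> r (- int n + 1) = 0" for n
  proof (induction n)
    case (Suc n)
    have eqs: "- int (Suc n) + 1 = - int n" "- int (Suc n) = - int n - 1" by simp_all
    show ?case unfolding eqs(1) unfolding eqs(2) using Suc rec[of "- int n"] by simp
  qed (use assms in auto)
  show ?thesis using up down by (cases j rule: int_cases2) auto
qed

lemma powi_rec:
  fixes z :: complex
  assumes "z \<noteq> 0" "2 * a = z + inverse z"
  shows "z powi (j + 1) + z powi (j - 1) = 2 * a * z powi j"
  using assms by (simp add: power_int_add power_int_diff divide_inverse algebra_simps)

text \<open>Both sides solve the recurrence in \<open>j\<close> and agree at 0 and 1. There is no
  division by z - 1/z, so a = 1 and a = -1 are included.\<close>

lemma powi_minus_eq_chebi: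
  assumes "z \<noteq> 0" "2 * a = z + inverse z"
  shows "z powi (- j) = chebi (j + 1) a - z * chebi j a"
proof -
  define r where "r j = z powi (- j) - (chebi (j + 1) a - z * chebi j a)" for j
  have "r (j + 1) + r (j - 1) = 2 * a * r j" for j
  proof -
    have "z powi (- (j + 1)) + z powi (- (j - 1)) = 2 * a * z powi (- j)"
    proof -
      have eqs: "- (j + 1) = - j - 1" "- (j - 1) = - j + 1" by simp_all
      show ?thesis unfolding eqs using powi_rec[OF assms, of "- j"] by (simp only: add.commute)
    qed
    moreover have "chebi (j + 1 + 1) a + chebi (j - 1 + 1) a = 2 * a * chebi (j + 1) a"
      using chebi_rec[of "j + 1" a] by simp
    moreover have "z * chebi (j + 1) a + z * chebi (j - 1) a = 2 * a * (z * chebi j a)"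
      using arg_cong[OF chebi_rec[of j a], of "\<lambda>t. z * t"] by (simp add: algebra_simps)
    ultimately show ?thesis unfolding r_def by (simp add: algebra_simps)
  qed
  moreover have "r 0 = 0" by (simp add: r_def chebi_def)
  moreover have "r 1 = 0" using assms by (simp add: r_def chebi_def numeral_2_eq_2 power_int_minus)
  ultimately have "r j = 0" by (rule recurrence_unique)
  then show ?thesis by (simp add: r_def)
qed

text \<open>A crude exponential bound in the index suffices, because \<open>f\<close> decays faster
  than every exponential.\<close>

lemma norm_cheb_le: "cmod (cheb n a) \<le> (2 * cmod a + 1) ^ n"
proof (induction n a rule: cheb.induct)
  case (3 n a)
  let ?B = "2 * cmod a + 1"
  have "cmod (cheb (Suc (Suc n)) a) \<le> 2 * cmod a * cmod (cheb (Suc n) a) + cmod (cheb n a)"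
    using norm_triangle_ineq4[of "2 * a * cheb (Suc n) a" "cheb n a"] by (simp add: norm_mult)
  also have "\<dots> \<le> 2 * cmod a * ?B ^ Suc n + ?B ^ Suc n"
    using 3 power_increasing[of n "Suc n" ?B] by (intro add_mono mult_left_mono) auto
  finally show ?case by (simp add: algebra_simps)
qed auto

lemma norm_chebi_le: "cmod (chebi j a) \<le> (2 * cmod a + 1) ^ nat \<bar>j\<bar>"
  using norm_cheb_le[of "nat \<bar>j\<bar>" a] by (auto simp: chebi_def norm_mult sgn_if)

lemma norm_chebi_le_exp:
  assumes "cmod a \<le> A" "\<bar>real_of_int j\<bar> \<le> t"
  shows "cmod (chebi j a) \<le> exp (ln (2 * A + 1) * t)"
proof -
  have "0 \<le> A" using assms(1) norm_ge_zero order_trans by blast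
  then have A: "2 * A + 1 \<ge> 1" by simp
  have "cmod (chebi j a) \<le> (2 * A + 1) ^ nat \<bar>j\<bar>"
    using assms(1) by (intro order_trans[OF norm_chebi_le] power_mono) auto
  also have "\<dots> = exp (ln (2 * A + 1)) ^ nat \<bar>j\<bar>"
    using A by simp
  also have "\<dots> = exp (ln (2 * A + 1) * real (nat \<bar>j\<bar>))"
    by (rule exp_of_nat2_mult[symmetric])
  also have "\<dots> \<le> exp (ln (2 * A + 1) * t)"
    unfolding exp_le_cancel_iff by (rule mult_left_mono) (use assms(2) A in auto)
  finally show ?thesis .
qed

lemma holomorphic_on_cheb:
  "g holomorphic_on S \<Longrightarrow> (\<lambda>t. cheb n (g t)) holomorphic_on S"
proof (induction n rule: induct_nat_012)
  case (ge2 n) then show ?case by (auto intro!: holomorphic_intros)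
qed (auto intro!: holomorphic_intros)

lemma norm_cos_le_exp: "cmod (cos z) \<le> exp \<bar>Im z\<bar>"
proof -
  have "cmod (cos z) \<le> (cmod (exp (\<i> * z)) + cmod (exp (- (\<i> * z)))) / 2"
    using norm_triangle_ineq[of "exp (\<i> * z)" "exp (- (\<i> * z))"]
    by (simp add: cos_exp_eq norm_divide del: norm_exp_eq_Re)
  also have "\<dots> = (exp (- Im z) + exp (Im z)) / 2" by simp
  also have "\<dots> \<le> (exp \<bar>Im z\<bar> + exp \<bar>Im z\<bar>) / 2"
    by (intro divide_right_mono add_mono) auto
  finally show ?thesis by simp
qed

section \<open>Vanishing of the Chebyshev sums of the source\<close>

context rellich
begin

text \<open>For z = e^{it} with cos t = a(p), U_{j-1}(a) is (z^j - z^{-j}) / (z - 1/z). The sum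
  therefore combines the values of \<open>fhat\<close> at the last angles t and -t, both 0. The
  strict bound |a(p)| < 1 makes z - 1/z nonzero.\<close>

lemma chebi_sum_elliptic:
  assumes "\<bar>symb N lam p\<bar> < 1"
  shows "(\<Sum>\<^sub>\<infinity>\<xi>\<in>lattice (Suc N). f \<xi> * (plane N p \<xi> * chebi (\<xi> N - m) (symb N lam p))) = 0"
proof -
  define a where "a = symb N lam p"
  define t where "t = arccos a"
  define z where "z = cis t"
  have a: "-1 < a" "a < 1" using assms by (auto simp: a_def)
  have ct: "cos t = a" using a by (simp add: t_def)
  have st: "sin t \<noteq> 0" using a by (simp add: t_def sin_arccos_nonzero)
  have z0: "z \<noteq> 0" and za: "2 * complex_of_real a = z + inverse z" and zc: "2 * complex_of_real a = inverse z + inverse (inverse z)"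
    and zz: "z - inverse z \<noteq> 0"
    using ct st by (auto simp: z_def complex_eq_iff)
  have ch: "chebi j a = (z powi j - z powi (- j)) / (z - inverse z)" for j
  proof -
    have "z powi (- j) = chebi (j + 1) a - z * chebi j a"
      by (rule powi_minus_eq_chebi[OF z0 za])
    moreover have "z powi j = chebi (j + 1) a - inverse z * chebi j a"
      using powi_minus_eq_chebi[OF _ zc, of j] z0 by (simp add: power_int_minus power_int_inverse)
    ultimately have "z powi j - z powi (- j) = chebi j a * (z - inverse z)"
      by (simp add: algebra_simps)
    then show ?thesis using zz by simp
  qed
  have E: "plane (Suc N) (p(N := s * arccos (symb N lam p))) \<xi> = plane N p \<xi> * cis (real_of_int (\<xi> N) * (s * t))" for s \<xi>
    unfolding plane_Suc by (simp add: t_def a_def mult.commute)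
  have sm: "(\<lambda>\<xi>. f \<xi> * plane (Suc N) x \<xi>) summable_on lattice (Suc N)" for x
    by (rule f_bounded_summable[of _ 1]) simp
  let ?P = "p(N := 1 * arccos (symb N lam p))" and ?M = "p(N := -1 * arccos (symb N lam p))"
  let ?c = "cis (- real_of_int m * t) / (z - inverse z)" and ?d = "- cis (real_of_int m * t) / (z - inverse z)"
  have "(\<Sum>\<^sub>\<infinity>\<xi>\<in>lattice (Suc N). f \<xi> * (plane N p \<xi> * chebi (\<xi> N - m) (symb N lam p)))
      = (\<Sum>\<^sub>\<infinity>\<xi>\<in>lattice (Suc N). ?c * (f \<xi> * plane (Suc N) ?P \<xi>) + ?d * (f \<xi> * plane (Suc N) ?M \<xi>))"
  proof (rule infsum_cong)
    fix \<xi> :: "nat \<Rightarrow> int"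
    have "z powi (\<xi> N - m) = cis (- real_of_int m * t) * cis (real_of_int (\<xi> N) * (1 * t))"
      by (simp add: z_def cis_power_int cis_mult algebra_simps)
    moreover have "z powi (- (\<xi> N - m)) = cis (real_of_int m * t) * cis (real_of_int (\<xi> N) * (-1 * t))"
      by (simp add: z_def cis_power_int cis_mult algebra_simps)
    ultimately show "f \<xi> * (plane N p \<xi> * chebi (\<xi> N - m) (symb N lam p))
        = ?c * (f \<xi> * plane (Suc N) ?P \<xi>) + ?d * (f \<xi> * plane (Suc N) ?M \<xi>)"
      unfolding E unfolding a_def[symmetric] ch diff_divide_distrib by (simp add: algebra_simps)
  qed
  also have "\<dots> = ?c * fhat ?P + ?d * fhat ?M"
    unfolding fhat_def infsum_cmult_right'[symmetric]
    by (rule infsum_add) (intro summable_on_cmult_right sm)+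
  also have "\<dots> = 0"
    using fhat_eq_0[OF assms, of 1] fhat_eq_0[OF assms, of "-1"] by simp
  finally show ?thesis .
qed

text \<open>If all N cosines equal c = 1 - 2 lam / (N + 1), then a is c as well, and 0 < lam < N + 1
  says that |c| < 1.\<close>

lemma exists_elliptic_point: "\<exists>p. \<bar>symb N lam p\<bar> < 1"
proof -
  define c where "c = 1 - 2 * lam / real (Suc N)"
  have c: "-1 < c" "c < 1" using lam by (auto simp: c_def field_simps)
  have "symb N lam (\<lambda>_. arccos c) = real (Suc N) - 2 * lam - N * c"
    using c by (simp add: symb_def)
  also have "\<dots> = c" by (simp add: c_def field_simps)
  finally show ?thesis using c by (intro exI[of _ "\<lambda>_. arccos c"]) auto
qed

text \<open>Analytic continuation along the complex line through an elliptic point p and x.\<close>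

lemma chebi_sum_eq_0:
  "(\<Sum>\<^sub>\<infinity>\<xi>\<in>lattice (Suc N). f \<xi> * (plane N x \<xi> * chebi (\<xi> N - m) (symb N lam x))) = 0"
proof -
  obtain p where p: "\<bar>symb N lam p\<bar> < 1" using exists_elliptic_point by blast
  define q where "q l = x l - p l" for l
  \<comment> \<open>The complex line with value p at 0 and x at 1. The estimates below are made on
    the disc of radius 2, whose interior contains both parameters.\<close>
  define X where "X t l = of_real (p l) + t * of_real (q l)" for t :: complex and l
  define E where "E t \<xi> = exp (\<i> * (\<Sum>l<N. X t l * of_int (\<xi> l)))" for t and \<xi> :: "nat \<Rightarrow> int"
  define a where "a t = of_real (real (Suc N) - 2 * lam) - (\<Sum>l<N. cos (X t l))" for t
  define h where "h \<xi> t = f \<xi> * (E t \<xi> * chebi (\<xi> N - m) (a t))" for \<xi> t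
  define g where "g t = (\<Sum>\<^sub>\<infinity>\<xi>\<in>lattice (Suc N). h \<xi> t)" for t
  have Xreal: "X (of_real t) l = of_real (p l + t * q l)" for t l by (simp add: X_def)
  have Er: "E (of_real t) \<xi> = plane N (\<lambda>l. p l + t * q l) \<xi>" for t \<xi>
    unfolding E_def plane_def cis_conv_exp Xreal by simp
  have ar: "a (of_real t) = of_real (symb N lam (\<lambda>l. p l + t * q l))" for t
    unfolding a_def symb_def Xreal cos_of_real by simp
  define Q where "Q = (\<Sum>l<N. \<bar>q l\<bar>)"
  have Q0: "Q \<ge> 0" by (simp add: Q_def sum_nonneg)
  have ImX: "\<bar>Im (X t l)\<bar> \<le> 2 * Q" if "t \<in> cball 0 2" "l < N" for t l
  proof -
    have "\<bar>Im (X t l)\<bar> = \<bar>Im t\<bar> * \<bar>q l\<bar>" by (simp add: X_def abs_mult)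
    also have "\<dots> \<le> 2 * Q"
      using that abs_Im_le_cmod[of t] member_le_sum[of l "{..<N}" "\<lambda>l. \<bar>q l\<bar>"]
      by (intro mult_mono) (auto simp: Q_def)
    finally show ?thesis .
  qed
  define A where "A = \<bar>real (Suc N) - 2 * lam\<bar> + N * exp (2 * Q)"
  have A0: "A \<ge> 0" by (simp add: A_def)
  have aA: "cmod (a t) \<le> A" if "t \<in> cball 0 2" for t
  proof -
    have "cmod (\<Sum>l<N. cos (X t l)) \<le> (\<Sum>l<N. exp (2 * Q))"
      by (rule sum_norm_le) (use ImX[OF that] in \<open>auto intro: order_trans[OF norm_cos_le_exp]\<close>)
    then show ?thesis
      unfolding a_def A_def by (intro order_trans[OF norm_triangle_ineq4] add_mono) (simp_all del: of_real_diff)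
  qed
  \<comment> \<open>The summand \<open>2 * Q\<close> accounts for the plane wave at complex
    frequencies, \<open>ln (2 * A + 1)\<close> for the growth of the Chebyshev polynomials in the
    index.\<close>
  define \<gamma> where "\<gamma> = 2 * Q + ln (2 * A + 1)"
  define C where "C = exp (ln (2 * A + 1) * \<bar>m\<bar>)"
  have g0: "\<gamma> \<ge> 0" using A0 Q0 by (simp add: \<gamma>_def)
  have bound: "cmod (E t \<xi> * chebi (\<xi> N - m) (a t)) \<le> C * exp (\<gamma> * l1 (Suc N) \<xi>)" if t: "t \<in> cball 0 2" for t \<xi>
  proof -
    have l1N: "l1 N \<xi> \<le> l1 (Suc N) \<xi>" and xN: "\<bar>real_of_int (\<xi> N)\<bar> \<le> l1 (Suc N) \<xi>"
      using l1_nonneg[of N \<xi>] by (auto simp: l1_def)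
    have "cmod (E t \<xi>) = exp (\<Sum>l<N. - (Im (X t l) * real_of_int (\<xi> l)))"
      by (simp add: E_def sum_negf)
    also have "\<dots> \<le> exp (\<Sum>l<N. 2 * Q * \<bar>real_of_int (\<xi> l)\<bar>)"
    proof (simp only: exp_le_cancel_iff, rule sum_mono)
      fix l assume "l \<in> {..<N}"
      then have "\<bar>Im (X t l)\<bar> * \<bar>real_of_int (\<xi> l)\<bar> \<le> 2 * Q * \<bar>real_of_int (\<xi> l)\<bar>"
        using ImX[OF t] by (intro mult_right_mono) auto
      then show "- (Im (X t l) * real_of_int (\<xi> l)) \<le> 2 * Q * \<bar>real_of_int (\<xi> l)\<bar>"
        using abs_ge_minus_self[of "Im (X t l) * real_of_int (\<xi> l)"] by (simp add: abs_mult)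
    qed
    also have "\<dots> \<le> exp (2 * Q * l1 (Suc N) \<xi>)"
      using l1N Q0 by (simp add: l1_def sum_distrib_left[symmetric] mult_left_mono)
    finally have 1: "cmod (E t \<xi>) \<le> exp (2 * Q * l1 (Suc N) \<xi>)" .
    have 2: "cmod (chebi (\<xi> N - m) (a t)) \<le> exp (ln (2 * A + 1) * (\<bar>m\<bar> + l1 (Suc N) \<xi>))"
      by (rule norm_chebi_le_exp[OF aA[OF t]]) (use xN in linarith)
    have "cmod (E t \<xi>) * cmod (chebi (\<xi> N - m) (a t))
        \<le> exp (2 * Q * l1 (Suc N) \<xi>) * exp (ln (2 * A + 1) * (\<bar>m\<bar> + l1 (Suc N) \<xi>))"
      by (intro mult_mono 1 2) auto
    also have "\<dots> = C * exp (\<gamma> * l1 (Suc N) \<xi>)"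
      by (simp add: C_def \<gamma>_def algebra_simps flip: exp_add)
    finally show ?thesis by (simp add: norm_mult)
  qed
  have hol_h: "h \<xi> holomorphic_on UNIV" for \<xi>
    unfolding h_def E_def a_def X_def chebi_def
    by (intro holomorphic_intros holomorphic_on_cheb)
  have ul: "uniform_limit (cball 0 2) (\<lambda>F t. \<Sum>\<xi>\<in>F. h \<xi> t) g (finite_subsets_at_top (lattice (Suc N)))"
    unfolding g_def
  proof (rule Weierstrass_m_test_general)
    fix \<xi> t assume "t \<in> cball (0::complex) 2"
    from mult_left_mono[OF bound[OF this], of "cmod (f \<xi>)" \<xi>]
    show "cmod (h \<xi> t) \<le> C * (exp (\<gamma> * l1 (Suc N) \<xi>) * cmod (f \<xi>))"
      by (simp add: h_def norm_mult mult_ac)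
  qed (intro summable_on_cmult_right f_summable g0)
  obtain gh: "g holomorphic_on ball 0 2"
  proof (rule holomorphic_uniform_limit[OF _ ul])
    show "\<forall>\<^sub>F F in finite_subsets_at_top (lattice (Suc N)).
      continuous_on (cball 0 2) (\<lambda>t. \<Sum>\<xi>\<in>F. h \<xi> t) \<and> (\<lambda>t. \<Sum>\<xi>\<in>F. h \<xi> t) holomorphic_on ball 0 2"
    proof (intro always_eventually allI conjI)
      fix F
      have "(\<lambda>t. \<Sum>\<xi>\<in>F. h \<xi> t) holomorphic_on UNIV" by (intro holomorphic_intros hol_h)
      then show "continuous_on (cball 0 2) (\<lambda>t. \<Sum>\<xi>\<in>F. h \<xi> t)" "(\<lambda>t. \<Sum>\<xi>\<in>F. h \<xi> t) holomorphic_on ball 0 2"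
        by (meson holomorphic_on_imp_continuous_on holomorphic_on_subset subset_UNIV)+
    qed
  qed (use that in auto)
  have greal: "g (of_real t) = (\<Sum>\<^sub>\<infinity>\<xi>\<in>lattice (Suc N). f \<xi> * (plane N (\<lambda>l. p l + t * q l) \<xi> * chebi (\<xi> N - m) (symb N lam (\<lambda>l. p l + t * q l))))" for t
    unfolding g_def h_def Er ar ..
  \<comment> \<open>For 0 < t < e the symbol moves by less than half of 1 - |a(p)|, so the real
    points of the line stay in the region |a| < 1.\<close>
  define e where "e = min 1 ((1 - \<bar>symb N lam p\<bar>) / (2 * (N * Q + 1)))"
  have NQ: "N * Q + 1 > 0" using Q0 by (simp add: add_nonneg_pos)
  have e: "e > 0" using p NQ by (simp add: e_def)
  have zero: "g (of_real t) = 0" if t: "0 < t" "t < e" for t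
  proof -
    have "\<bar>symb N lam (\<lambda>l. p l + t * q l) - symb N lam p\<bar> \<le> N * (e * Q)"
    proof (rule symb_lipschitz)
      fix l assume "l < N"
      then have "\<bar>q l\<bar> \<le> Q" using member_le_sum[of l "{..<N}" "\<lambda>l. \<bar>q l\<bar>"] by (auto simp: Q_def)
      then show "\<bar>p l + t * q l - p l\<bar> \<le> e * Q" using t by (simp add: abs_mult mult_mono)
    qed
    also have "N * (e * Q) < e * (N * Q + 1)" using e by (simp add: algebra_simps)
    also have "\<dots> \<le> (1 - \<bar>symb N lam p\<bar>) / (2 * (N * Q + 1)) * (N * Q + 1)"
      using NQ by (intro mult_right_mono) (auto simp: e_def)
    also have "\<dots> = (1 - \<bar>symb N lam p\<bar>) / 2" using NQ by (simp add: field_simps)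
    finally have "\<bar>symb N lam (\<lambda>l. p l + t * q l)\<bar> < 1"
      using p abs_triangle_ineq2[of "symb N lam (\<lambda>l. p l + t * q l)" "symb N lam p"] by (simp add: field_simps)
    then show ?thesis unfolding greal by (rule chebi_sum_elliptic)
  qed
  \<comment> \<open>The zeros of \<open>g\<close> at small positive t accumulate at 0, so the
    identity theorem applies on the disc.\<close>
  have "g 1 = 0"
  proof (rule analytic_continuation[OF gh, of "of_real ` {0<..<e}" 0])
    show "of_real ` {0<..<e} \<subseteq> ball (0::complex) 2" by (auto simp: e_def)
    show "(0::complex) islimpt of_real ` {0<..<e}"
      unfolding islimpt_approachable
    proof (intro allI impI)
      fix d :: real assume "d > 0"
      then show "\<exists>w\<in>of_real ` {0<..<e}. w \<noteq> (0::complex) \<and> dist w 0 < d"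
        using e by (intro bexI[of _ "of_real (min d e / 2)"] imageI) auto
    qed
  qed (use zero in auto)
  then show ?thesis using greal[of 1] by (simp add: q_def)
qed

end

section \<open>The bounded Green kernel and the cone\<close>

text \<open>The roots a + s and a - s of z^2 - 2 a z + 1 have product 1, so at least one lies in the
  closed unit disc.\<close>

lemma exists_small_root:
  fixes a :: complex
  shows "\<exists>z. z \<noteq> 0 \<and> cmod z \<le> 1 \<and> 2 * a = z + inverse z"
proof -
  define s where "s = csqrt (a\<^sup>2 - 1)"
  have prod: "(a + s) * (a - s) = 1"
    using power2_csqrt[of "a\<^sup>2 - 1"] by (simp add: s_def algebra_simps power2_eq_square)
  have inv: "inverse (a + s) = a - s" "inverse (a - s) = a + s"
    using prod by (auto intro!: inverse_unique simp: mult.commute)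
  have nz: "a + s \<noteq> 0" "a - s \<noteq> 0" using prod by auto
  have "cmod (a + s) * cmod (a - s) = 1" using prod by (metis norm_mult norm_one)
  then have "cmod (a + s) \<le> 1 \<or> cmod (a - s) \<le> 1"
    by (metis mult_less_cancel_left2 linorder_not_le norm_ge_zero less_1_mult less_irrefl)
  then show ?thesis using inv nz by (metis add_diff_cancel add_diff_eq diff_add_cancel mult_2 add.commute)
qed

section \<open>Finite propagation for polynomials in the symbol\<close>

lemma symb_mult_plane:
  "2 * of_real (symb N lam x) * plane N x \<xi> = of_real (2 * real (Suc N) - 4 * lam) * plane N x \<xi>
     - (\<Sum>l<N. plane N x (\<xi>(l := \<xi> l + 1)) + plane N x (\<xi>(l := \<xi> l - 1)))"
proof -
  have "(\<Sum>l<N. plane N x (\<xi>(l := \<xi> l + 1)) + plane N x (\<xi>(l := \<xi> l - 1)))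
      = (\<Sum>l<N. 2 * of_real (cos (x l)) * plane N x \<xi>)"
  proof (rule sum.cong)
    fix l assume l: "l \<in> {..<N}"
    have "cis (x l) + cis (- x l) = 2 * of_real (cos (x l))" by (simp add: complex_eq_iff)
    then show "plane N x (\<xi>(l := \<xi> l + 1)) + plane N x (\<xi>(l := \<xi> l - 1)) = 2 * of_real (cos (x l)) * plane N x \<xi>"
      using plane_upd[of l N x \<xi> 1] plane_upd[of l N x \<xi> "-1"] l by (simp flip: distrib_right)
  qed simp
  then show ?thesis
    by (simp add: symb_def algebra_simps sum_distrib_left sum_distrib_right)
qed

lemma sum_grid_plane:
  assumes "L > 0" "\<And>l. l < N \<Longrightarrow> \<bar>d l\<bar> < int L"
  shows "(\<Sum>y\<in>box_lat N {0..<int L}. plane N (grid (\<lambda>_. 0) L y) d) = (if \<forall>l<N. d l = 0 then of_nat L ^ N else 0)"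
  using sum_box_lat_cis[of L N d 0] assms by (simp add: plane_def grid_def mult_ac)

lemma sum_grid_plane_eq_0:
  assumes "L > 0" "\<And>l. l < N \<Longrightarrow> \<bar>d l\<bar> < int L" "0 < (\<Sum>l<N. \<bar>d l\<bar>)"
  shows "(\<Sum>y\<in>box_lat N {0..<int L}. plane N (grid (\<lambda>_. 0) L y) d) = 0"
proof -
  have nz: "\<not> (\<forall>l<N. d l = 0)"
  proof
    assume "\<forall>l<N. d l = 0"
    then have "(\<Sum>l<N. \<bar>d l\<bar>) = 0" by (intro sum.neutral) auto
    then show False using assms(3) by simp
  qed
  from sum_grid_plane[of L N d, OF assms(1,2)] show ?thesis unfolding if_not_P[OF nz] .
qed

text \<open>U_j(a) has degree j, and by \<open>symb_mult_plane\<close> each multiplication by a(x)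
  moves \<open>d\<close> by at most one lattice step, so the Fourier coefficients vanish at l1
  distance beyond j. The bound on \<open>\<bar>d l\<bar> + int j\<close> keeps all displaced points
  within one period.\<close>

lemma sum_grid_cheb_eq_0:
  fixes d :: "nat \<Rightarrow> int"
  assumes L: "L > 0" and "\<And>l. l < N \<Longrightarrow> \<bar>d l\<bar> + int j < int L" and "int j < (\<Sum>l<N. \<bar>d l\<bar>)"
  shows "(\<Sum>y\<in>box_lat N {0..<int L}. plane N (grid (\<lambda>_. 0) L y) d * cheb (Suc j) (symb N lam (grid (\<lambda>_. 0) L y))) = 0"
  using assms(2,3)
proof (induction j arbitrary: d rule: less_induct)
  case (less j)
  let ?Y = "box_lat N {0..<int L}" and ?x = "grid (\<lambda>_. 0) L"
  show ?case
  proof (cases j)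
    case 0
    then show ?thesis using sum_grid_plane_eq_0[OF L, of N d] less.prems by simp
  next
    case (Suc i)
    have IH: "(\<Sum>y\<in>?Y. plane N (?x y) d' * cheb (Suc i) (symb N lam (?x y))) = 0"
      if "\<And>l. l < N \<Longrightarrow> \<bar>d' l\<bar> + int i < int L" "int i < (\<Sum>l<N. \<bar>d' l\<bar>)" for d'
      using less.IH[of i d'] Suc that by simp
    \<comment> \<open>A step to a neighbour lowers the l1 distance by at most 1, which matches the
      drop of the degree from \<open>j\<close> to \<open>i\<close>.\<close>
    have nb: "(\<Sum>y\<in>?Y. plane N (?x y) (d(l := d l + e)) * cheb (Suc i) (symb N lam (?x y))) = 0"
      if l: "l < N" and e: "\<bar>e\<bar> \<le> 1" for l e
    proof (rule IH)
      show "\<bar>(d(l := d l + e)) k\<bar> + int i < int L" if "k < N" for k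
        using less.prems(1)[OF that] e Suc by auto
      have "(\<Sum>k<N. \<bar>d k\<bar>) \<le> (\<Sum>k<N. \<bar>(d(l := d l + e)) k\<bar> + (if k = l then 1 else 0))"
        by (rule sum_mono) (use e in auto)
      also have "\<dots> = (\<Sum>k<N. \<bar>(d(l := d l + e)) k\<bar>) + 1"
        using l by (simp add: sum.distrib)
      finally show "int i < (\<Sum>k<N. \<bar>(d(l := d l + e)) k\<bar>)"
        using less.prems(2) Suc by linarith
    qed
    have same: "(\<Sum>y\<in>?Y. plane N (?x y) d * cheb (Suc i) (symb N lam (?x y))) = 0"
      using less.prems Suc by (intro IH) fastforce+
    \<comment> \<open>For \<open>i = 0\<close> the term is 0 because \<open>cheb 0\<close> is
      0.\<close>
    have prev: "(\<Sum>y\<in>?Y. plane N (?x y) d * cheb i (symb N lam (?x y))) = 0"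
    proof (cases i)
      case (Suc i')
      have "\<bar>d l\<bar> + int i' < int L" if "l < N" for l
        using less.prems(1)[OF that] Suc \<open>j = Suc i\<close> by simp
      moreover have "int i' < (\<Sum>l<N. \<bar>d l\<bar>)" using less.prems(2) Suc \<open>j = Suc i\<close> by simp
      ultimately show ?thesis using less.IH[of i' d] Suc \<open>j = Suc i\<close> by simp
    qed simp
    have "(\<Sum>y\<in>?Y. (2 * of_real (symb N lam (?x y)) * plane N (?x y) d) * cheb (Suc i) (symb N lam (?x y)))
        = of_real (2 * real (Suc N) - 4 * lam) * (\<Sum>y\<in>?Y. plane N (?x y) d * cheb (Suc i) (symb N lam (?x y)))
          - (\<Sum>l<N. (\<Sum>y\<in>?Y. plane N (?x y) (d(l := d l + 1)) * cheb (Suc i) (symb N lam (?x y)))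
                  + (\<Sum>y\<in>?Y. plane N (?x y) (d(l := d l - 1)) * cheb (Suc i) (symb N lam (?x y))))"
      unfolding symb_mult_plane left_diff_distrib sum_subtractf sum_distrib_right sum_distrib_left
        sum.distrib[symmetric] distrib_right[symmetric]
      by (subst (2) sum.swap) (simp add: mult.assoc)
    also have "\<dots> = 0"
      using nb[of _ 1] nb[of _ "-1"] same by simp
    finally show ?thesis
      using prev Suc by (simp add: right_diff_distrib sum_subtractf mult_ac)
  qed
qed

lemma plane_diff: "plane N x (\<lambda>l. \<xi> l - \<eta> l) = plane N x \<xi> * cnj (plane N x \<eta>)"
  by (simp add: plane_def cis_cnj cis_mult right_diff_distrib sum_subtractf)

lemma abs_le_l1: "l < n \<Longrightarrow> \<bar>real_of_int (\<xi> l)\<bar> \<le> l1 n \<xi>"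
  unfolding l1_def by (rule member_le_sum) auto

lemma abs_symb_le: "\<bar>symb N lam x\<bar> \<le> \<bar>real (Suc N) - 2 * lam\<bar> + N"
proof -
  have "\<bar>\<Sum>l<N. cos (x l)\<bar> \<le> (\<Sum>l<N. 1)"
    by (rule order_trans[OF sum_abs], rule sum_mono) simp
  then show ?thesis unfolding symb_def by simp
qed

text \<open>The value 0 at j = 0, in place of z^0 = 1, leaves the sources at -1 and 1. For z^2
  \<noteq> 1 the kernel is g(j+1) - g(j-1) with the Green function g(j) = z^|j| / (z - 1/z); unlike
  g, it stays bounded as z approaches 1 or -1 in the unit disc.\<close>

lemma sgn_power_rec:
  fixes z :: complex and j :: int
  assumes "2 * a = z + inverse z" "z \<noteq> 0"
  defines "G \<equiv> \<lambda>j. of_int (sgn j) * z ^ nat \<bar>j\<bar>"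
  shows "G (j + 1) + G (j - 1) - 2 * a * G j = (if j = -1 then 1 else if j = 1 then -1 else 0)"
proof -
  have pos: "z ^ Suc (Suc n) + z ^ n - 2 * a * z ^ Suc n = 0" for n
  proof -
    have "2 * a * z ^ Suc n = (z + inverse z) * z ^ Suc n" by (simp only: assms(1))
    also have "\<dots> = z ^ Suc (Suc n) + z ^ n" using assms(2) by (simp add: distrib_right)
    finally show ?thesis by simp
  qed
  consider "j = 0" | "j = 1" | "j = -1" | n where "n > 0" "j = int (Suc n)" | n where "n > 0" "j = - int (Suc n)"
  proof -
    have "j = 0 \<or> j = 1 \<or> j = -1 \<or> (nat j - 1 > 0 \<and> j = int (Suc (nat j - 1))) \<or> (nat (-j) - 1 > 0 \<and> j = - int (Suc (nat (-j) - 1)))"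
      by linarith
    then show ?thesis using that by blast
  qed
  then show ?thesis
  proof cases
    case (4 n)
    then have "nat \<bar>j + 1\<bar> = Suc (Suc n)" "nat \<bar>j\<bar> = Suc n" "nat \<bar>j - 1\<bar> = n" "sgn (j + 1) = 1" "sgn j = 1" "sgn (j - 1) = 1"
      "j \<noteq> 1" "j \<noteq> -1" by auto
    then show ?thesis using pos[of n] by (simp add: G_def)
  next
    case (5 n)
    then have "nat \<bar>j - 1\<bar> = Suc (Suc n)" "nat \<bar>j\<bar> = Suc n" "nat \<bar>j + 1\<bar> = n" "sgn (j + 1) = -1" "sgn j = -1" "sgn (j - 1) = -1"
      "j \<noteq> 1" "j \<noteq> -1" by auto
    then show ?thesis using pos[of n] by (simp add: G_def) (simp add: algebra_simps)
  qed (use assms in \<open>simp_all add: G_def numeral_2_eq_2 algebra_simps\<close>)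
qed

text \<open>The kernel sgn(j) z^{|j|} + z^{-j}, written as a polynomial in a.\<close>

definition causal :: "int \<Rightarrow> complex \<Rightarrow> complex" where
  "causal j a = (if j < 0 then 0 else if j = 0 then 1 else chebi (j + 1) a - chebi (j - 1) a)"

text \<open>For j < 0 the two powers cancel; for j > 0 they add up to z^j + z^{-j} = 2 T_j(a) =
  U_j(a) - U_{j-2}(a). At j = 0 the sign removes one of them, hence the value 1.\<close>

lemma causal_eq:
  assumes z: "z \<noteq> 0" "2 * a = z + inverse z"
  shows "causal j a = of_int (sgn j) * z ^ nat \<bar>j\<bar> + z powi (- j)"
proof -
  consider "j < 0" | "j = 0" | "j > 0" by linarith
  then show ?thesis
  proof cases
    case 1
    then have "z powi (- j) = z ^ nat \<bar>j\<bar>" by (simp add: power_int_def)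
    then show ?thesis using 1 by (simp add: causal_def)
  next
    case 3
    have z': "inverse z \<noteq> 0" "2 * a = inverse z + inverse (inverse z)" using z by (auto simp: add.commute)
    have "z powi (- j) = chebi (j + 1) a - z * chebi j a"
      by (rule powi_minus_eq_chebi[OF z])
    moreover have "z powi j = chebi (j + 1) a - inverse z * chebi j a"
      using powi_minus_eq_chebi[OF z', of j] by (simp add: power_int_minus power_int_inverse)
    moreover have "of_int (sgn j) * z ^ nat \<bar>j\<bar> = z powi j" using 3 by (simp add: power_int_def)
    ultimately have "of_int (sgn j) * z ^ nat \<bar>j\<bar> + z powi (- j)
        = chebi (j + 1) a - inverse z * chebi j a + (chebi (j + 1) a - z * chebi j a)"
      by (simp only:)
    also have "\<dots> = 2 * chebi (j + 1) a - (z + inverse z) * chebi j a"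
      by (simp add: algebra_simps)
    also have "\<dots> = chebi (j + 1) a - chebi (j - 1) a"
      unfolding z(2)[symmetric] chebi_rec[symmetric] by simp
    finally show ?thesis using 3 by (simp add: causal_def)
  qed (simp add: causal_def)
qed

lemma norm_causal_le:
  assumes "cmod a \<le> A" "\<bar>real_of_int j\<bar> \<le> t"
  shows "cmod (causal j a) \<le> 2 * exp (ln (2 * A + 1) * (t + 1))"
proof -
  have A: "0 \<le> A" using assms(1) norm_ge_zero order_trans by blast
  have t: "t \<ge> 0" using assms(2) by linarith
  have 1: "cmod (chebi (j + 1) a) \<le> exp (ln (2 * A + 1) * (t + 1))"
    "cmod (chebi (j - 1) a) \<le> exp (ln (2 * A + 1) * (t + 1))"
    by (rule norm_chebi_le_exp[OF assms(1)]; use assms(2) in simp)+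
  have "1 \<le> exp (ln (2 * A + 1) * (t + 1))" using A t by simp
  moreover have "cmod (chebi (j + 1) a - chebi (j - 1) a) \<le> 2 * exp (ln (2 * A + 1) * (t + 1))"
    using norm_triangle_ineq4[of "chebi (j + 1) a" "chebi (j - 1) a"] 1 by linarith
  moreover have "causal j a = 0 \<or> causal j a = 1 \<or> causal j a = chebi (j + 1) a - chebi (j - 1) a"
    by (simp add: causal_def)
  moreover have "0 \<le> 2 * exp (ln (2 * A + 1) * (t + 1))" by simp
  ultimately show ?thesis by (smt (verit) norm_zero norm_one)
qed

text \<open>The bound on d l excludes wrap-around on the grid of period L.\<close>

lemma sum_grid_causal_eq_0:
  fixes d :: "nat \<Rightarrow> int"
  assumes L: "L > 0" and d: "\<And>l. l < N \<Longrightarrow> \<bar>d l\<bar> + \<bar>j\<bar> < int L" "j < (\<Sum>l<N. \<bar>d l\<bar>)"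
  shows "(\<Sum>y\<in>box_lat N {0..<int L}. plane N (grid (\<lambda>_. 0) L y) d * causal j (symb N lam (grid (\<lambda>_. 0) L y))) = 0"
proof (cases "j \<le> 0")
  case True
  show ?thesis
  proof (cases "j = 0")
    case True
    then show ?thesis using sum_grid_plane_eq_0[OF L, of N d] d by (simp add: causal_def)
  qed (use True in \<open>simp add: causal_def\<close>)
next
  case False
  then obtain i where i: "j = int (Suc i)" by (metis not_le zero_less_imp_eq_int gr0_implies_Suc)
  have 1: "(\<Sum>y\<in>box_lat N {0..<int L}. plane N (grid (\<lambda>_. 0) L y) d * cheb (Suc (Suc i)) (symb N lam (grid (\<lambda>_. 0) L y))) = 0"
    using d i by (intro sum_grid_cheb_eq_0[OF L]) auto
  have 2: "(\<Sum>y\<in>box_lat N {0..<int L}. plane N (grid (\<lambda>_. 0) L y) d * cheb i (symb N lam (grid (\<lambda>_. 0) L y))) = 0"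
  proof (cases i)
    case (Suc i')
    then show ?thesis using d i by (simp only: Suc, intro sum_grid_cheb_eq_0[OF L]) fastforce+
  qed simp
  have c: "causal j a = cheb (Suc (Suc i)) a - cheb i a" for a
  proof -
    have "nat \<bar>j + 1\<bar> = Suc (Suc i)" "nat \<bar>j - 1\<bar> = i" "sgn (j + 1) = 1" using i by auto
    moreover have "of_int (sgn (j - 1)) * cheb i a = cheb i a" using i by (cases i) auto
    ultimately show ?thesis using False by (simp add: causal_def chebi_def del: cheb.simps(3))
  qed
  show ?thesis using 1 2 by (simp only: c right_diff_distrib sum_subtractf) simp
qed

section \<open>Periodicity and vanishing of u on the cone\<close>

context rellich
begin

text \<open>The kernels differ by z^{-(xi_N - m)}, a combination of two values of
  \<open>chebi\<close> with coefficients 1 and -z independent of xi; \<open>chebi_sum_eq_0\<close>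
  removes both. This covers |z| < 1 as well, where the added power grows with xi_N.\<close>

lemma inner_sum_causal:
  assumes z: "z \<noteq> 0" "cmod z \<le> 1" "2 * complex_of_real (symb N lam x) = z + inverse z"
  shows "(\<Sum>\<^sub>\<infinity>\<xi>\<in>lattice (Suc N). f \<xi> * (plane N x \<xi> * (of_int (sgn (\<xi> N - m)) * z ^ nat \<bar>\<xi> N - m\<bar>)))
       = (\<Sum>\<^sub>\<infinity>\<xi>\<in>lattice (Suc N). f \<xi> * (plane N x \<xi> * causal (\<xi> N - m) (symb N lam x)))"
    (is "?lhs = ?rhs")
proof -
  let ?a = "complex_of_real (symb N lam x)"
  define A where "A = \<bar>symb N lam x\<bar>"
  have A: "cmod ?a \<le> A" by (simp add: A_def)
  have lnA: "ln (2 * A + 1) \<ge> 0" by (simp add: A_def)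
  have sm: "(\<lambda>\<xi>. f \<xi> * (plane N x \<xi> * chebi (\<xi> N - m') ?a)) summable_on lattice (Suc N)" for m'
  proof (rule f_mult_summable(2)[OF lnA])
    fix \<xi> :: "nat \<Rightarrow> int"
    have "\<bar>real_of_int (\<xi> N - m')\<bar> \<le> \<bar>m'\<bar> + l1 (Suc N) \<xi>"
      using abs_le_l1[of N "Suc N" \<xi>] by simp
    from norm_chebi_le_exp[OF A this]
    show "cmod (plane N x \<xi> * chebi (\<xi> N - m') ?a) \<le> exp (ln (2 * A + 1) * \<bar>m'\<bar>) * exp (ln (2 * A + 1) * l1 (Suc N) \<xi>)"
      by (simp add: norm_mult distrib_left exp_add)
  qed
  have sG: "(\<lambda>\<xi>. f \<xi> * (plane N x \<xi> * (of_int (sgn (\<xi> N - m)) * z ^ nat \<bar>\<xi> N - m\<bar>))) summable_on lattice (Suc N)"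
  proof (rule f_bounded_summable)
    fix \<xi> :: "nat \<Rightarrow> int"
    show "cmod (plane N x \<xi> * (of_int (sgn (\<xi> N - m)) * z ^ nat \<bar>\<xi> N - m\<bar>)) \<le> 1"
      using z(2) by (auto simp: norm_mult norm_power power_le_one sgn_if)
  qed
  have "?rhs = (\<Sum>\<^sub>\<infinity>\<xi>\<in>lattice (Suc N). f \<xi> * (plane N x \<xi> * (of_int (sgn (\<xi> N - m)) * z ^ nat \<bar>\<xi> N - m\<bar>))
      + (f \<xi> * (plane N x \<xi> * chebi (\<xi> N - (m - 1)) ?a) + (- z) * (f \<xi> * (plane N x \<xi> * chebi (\<xi> N - m) ?a))))"
  proof (rule infsum_cong)
    fix \<xi> :: "nat \<Rightarrow> int"
    have "\<xi> N - m + 1 = \<xi> N - (m - 1)" by simp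
    then have pt: "causal (\<xi> N - m) ?a = of_int (sgn (\<xi> N - m)) * z ^ nat \<bar>\<xi> N - m\<bar>
        + (chebi (\<xi> N - (m - 1)) ?a - z * chebi (\<xi> N - m) ?a)"
      using causal_eq[OF z(1,3), of "\<xi> N - m"] powi_minus_eq_chebi[OF z(1,3), of "\<xi> N - m"]
      by (simp only:)
    show "f \<xi> * (plane N x \<xi> * causal (\<xi> N - m) ?a)
      = f \<xi> * (plane N x \<xi> * (of_int (sgn (\<xi> N - m)) * z ^ nat \<bar>\<xi> N - m\<bar>))
      + (f \<xi> * (plane N x \<xi> * chebi (\<xi> N - (m - 1)) ?a) + (- z) * (f \<xi> * (plane N x \<xi> * chebi (\<xi> N - m) ?a)))"
      unfolding pt by (simp only: distrib_left right_diff_distrib mult_ac) simp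
  qed
  also have "\<dots> = ?lhs + ((\<Sum>\<^sub>\<infinity>\<xi>\<in>lattice (Suc N). f \<xi> * (plane N x \<xi> * chebi (\<xi> N - (m - 1)) ?a))
      + (- z) * (\<Sum>\<^sub>\<infinity>\<xi>\<in>lattice (Suc N). f \<xi> * (plane N x \<xi> * chebi (\<xi> N - m) ?a)))"
    unfolding infsum_cmult_right'[symmetric]
    by (subst infsum_add; (intro sG sm summable_on_add summable_on_cmult_right)?)
       (subst infsum_add; (intro sG sm summable_on_add summable_on_cmult_right)?; simp)
  finally show ?thesis unfolding chebi_sum_eq_0 by simp
qed

text \<open>The limit of one pairing is found twice: on the side of \<open>u\<close> it is a quarter
  of the difference of the two values, on the side of \<open>f\<close> it is 0.\<close>

lemma u_periodic_on_cone:
  assumes \<xi>0: "\<xi>0 \<in> cone (Suc N)"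
  shows "u (\<xi>0(N := \<xi>0 N + 1)) = u (\<xi>0(N := \<xi>0 N - 1))"
proof -
  let ?n = "Suc N"
  define m where "m = \<xi>0 N"
  have \<xi>0L: "\<xi>0 \<in> lattice ?n" and \<xi>0c: "(\<Sum>i<N. \<bar>\<xi>0 i\<bar>) \<le> m" using \<xi>0 by (auto simp: cone_def m_def)
  define R where "R = (\<Sum>l<?n. nat \<bar>\<xi>0 l\<bar>)"
  have R: "\<bar>\<xi>0 l\<bar> \<le> int R" if "l < ?n" for l
  proof -
    have "nat \<bar>\<xi>0 l\<bar> \<le> R" unfolding R_def by (rule member_le_sum) (use that in auto)
    then show ?thesis by linarith
  qed
  \<comment> \<open>The coordinates of \<open>\<xi>0\<close> are at most \<open>R\<close>. Two
    copies of \<open>R\<close> leave room for both displacements,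
    \<open>\<bar>\<xi> l - \<xi>0 l\<bar>\<close> and \<open>\<bar>\<xi> N - m\<bar>\<close>, in the
    condition against wrap-around.\<close>
  define L where "L k = 2 * k + 5 + 2 * R" for k
  have L0: "L k > 0" for k by (simp add: L_def)
  define Y where "Y k = box_lat N {0..<int (L k)}" for k
  define x where "x k = grid (\<lambda>_. 0) (L k)" for k
  define Z where "Z a = (SOME z. z \<noteq> 0 \<and> cmod z \<le> 1 \<and> 2 * complex_of_real a = z + inverse z)" for a
  have Z: "Z a \<noteq> 0" "cmod (Z a) \<le> 1" "2 * complex_of_real a = Z a + inverse (Z a)" for a
    using someI_ex[OF exists_small_root[of "complex_of_real a"]] unfolding Z_def by blast+
  define G where "G a j = of_int (sgn j) * Z a ^ nat \<bar>j\<bar>" for a and j :: int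
  have G1: "cmod (G a j) \<le> 1" for a j
    using Z(2)[of a] by (auto simp: G_def norm_mult norm_power power_le_one sgn_if)
  \<comment> \<open>The conjugate plane wave and the shift by \<open>m\<close> centre the kernel at
    \<open>\<xi>0\<close>.\<close>
  define c where "c k y j = cnj (plane N (x k y) \<xi>0) * G (symb N lam (x k y)) (j - m)" for k y j
  define \<Psi> where "\<Psi> k \<xi> = (\<Sum>y\<in>Y k. c k y (\<xi> N) * plane N (grid (\<lambda>_. 0) (L k) y) \<xi>) / of_nat (L k ^ N)" for k \<xi>
  have lim: "(\<lambda>k. (\<Sum>\<xi>\<in>lat_ball ?n (real k + 1). u \<xi> * cutoff ?n k \<xi> * (disc_lap_neg ?n (\<Psi> k) \<xi> - of_real lam * \<Psi> k \<xi>))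
            - (\<Sum>\<^sub>\<infinity>\<xi>\<in>lattice ?n. f \<xi> * \<Psi> k \<xi>)) \<longlonglongrightarrow> 0"
    unfolding \<Psi>_def
  proof (rule test_modes[where W = 1])
    show "cmod (c k y j) \<le> 1" for k y j using G1 by (simp add: c_def norm_mult)
  qed (auto simp: L_def Y_def)
  have fY: "finite (Y k)" for k by (simp add: Y_def finite_box_lat)

  define up where "up = \<xi>0(N := m + 1)"
  define dn where "dn = \<xi>0(N := m - 1)"
  have ne: "up \<noteq> dn"
  proof
    assume "up = dn"
    from fun_cong[OF this, of N] show False by (simp add: up_def dn_def)
  qed
  have udL: "up \<in> lattice ?n" "dn \<in> lattice ?n"
    using \<xi>0L by (auto simp: up_def dn_def intro: upd_in_lattice)
  \<comment> \<open>The recurrence leaves sources only at heights m - 1 and m + 1. Averaging plane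
    waves over the grid gives a delta in the first N coordinates, as points of the ball differ from
    \<open>\<xi>0\<close> there by less than a period.\<close>
  have PPsi: "disc_lap_neg ?n (\<Psi> k) \<xi> - of_real lam * \<Psi> k \<xi> = (if \<xi> = dn then - 1/4 else if \<xi> = up then 1/4 else 0)"
    if \<xi>: "\<xi> \<in> lat_ball ?n (real k + 1)" for k \<xi>
  proof -
    define q :: complex where "q = of_nat (L k ^ N)"
    have q0: "q \<noteq> 0" using L0[of k] by (simp add: q_def)
    define \<delta> :: complex where "\<delta> = (if \<xi> N - m = -1 then 1 else if \<xi> N - m = 1 then -1 else 0)"
    have eq: "\<Psi> k = (\<lambda>\<xi>. \<Sum>y\<in>Y k. (c k y (\<xi> N) / q) * plane N (x k y) \<xi>)"
      by (simp add: \<Psi>_def sum_divide_distrib fun_eq_iff q_def x_def)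
    have rec: "c k y (\<xi> N + 1) / q + c k y (\<xi> N - 1) / q - 2 * of_real (symb N lam (x k y)) * (c k y (\<xi> N) / q)
        = \<delta> * cnj (plane N (x k y) \<xi>0) / q" for y
    proof -
      have "G (symb N lam (x k y)) (\<xi> N + 1 - m) + G (symb N lam (x k y)) (\<xi> N - 1 - m)
          - 2 * of_real (symb N lam (x k y)) * G (symb N lam (x k y)) (\<xi> N - m) = \<delta>"
        using sgn_power_rec[OF Z(3) Z(1), where j = "\<xi> N - m"]
        by (simp add: G_def \<delta>_def algebra_simps)
      from arg_cong[OF this, of "\<lambda>t. t * cnj (plane N (x k y) \<xi>0) / q"]
      show ?thesis by (simp add: c_def algebra_simps add_divide_distrib diff_divide_distrib)
    qed
    have "disc_lap_neg ?n (\<Psi> k) \<xi> - of_real lam * \<Psi> k \<xi>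
        = - (1/4) * (\<Sum>y\<in>Y k. \<delta> * cnj (plane N (x k y) \<xi>0) / q * plane N (x k y) \<xi>)"
      unfolding eq disc_lap_neg_modes[where c = "\<lambda>y m. c k y m / q"] rec ..
    also have "\<dots> = - (1/4) * (\<delta> / q * (\<Sum>y\<in>Y k. plane N (x k y) (\<lambda>l. \<xi> l - \<xi>0 l)))"
      unfolding plane_diff sum_distrib_left by (simp add: mult_ac)
    also have "(\<Sum>y\<in>Y k. plane N (x k y) (\<lambda>l. \<xi> l - \<xi>0 l)) = (if \<forall>l<N. \<xi> l = \<xi>0 l then q else 0)"
    proof -
      have "\<bar>\<xi> l - \<xi>0 l\<bar> < int (L k)" if "l < N" for l
      proof -
        have "\<bar>real_of_int (\<xi> l)\<bar> \<le> real k + 1"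
          using \<xi> abs_le_lat_norm[of l ?n \<xi>] that by (auto simp: lat_ball_def)
        then have "\<bar>\<xi> l\<bar> \<le> int k + 1" by linarith
        then show ?thesis using R[of l] that by (simp add: L_def)
      qed
      from sum_grid_plane[of "L k" N "\<lambda>l. \<xi> l - \<xi>0 l", OF L0 this]
      show ?thesis by (auto simp: Y_def x_def q_def)
    qed
    also have "- (1/4) * (\<delta> / q * (if \<forall>l<N. \<xi> l = \<xi>0 l then q else 0)) = (if \<xi> = dn then - 1/4 else if \<xi> = up then 1/4 else 0)"
    proof -
      have *: "\<xi> = \<xi>0(N := v) \<longleftrightarrow> (\<forall>l<N. \<xi> l = \<xi>0 l) \<and> \<xi> N = v" for v
      proof
        assume eq: "(\<forall>l<N. \<xi> l = \<xi>0 l) \<and> \<xi> N = v"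
        show "\<xi> = \<xi>0(N := v)"
        proof
          fix l
          consider "l < N" | "l = N" | "l \<ge> ?n" by linarith
          then show "\<xi> l = (\<xi>0(N := v)) l"
            using eq \<xi> \<xi>0L by cases (auto simp: lat_ball_def lattice_def)
        qed
      qed auto
      show ?thesis unfolding up_def dn_def * using q0 by (auto simp: \<delta>_def)
    qed
    finally show ?thesis .
  qed
  have left: "(\<lambda>k. (\<Sum>\<xi>\<in>lat_ball ?n (real k + 1). u \<xi> * cutoff ?n k \<xi> * (disc_lap_neg ?n (\<Psi> k) \<xi> - of_real lam * \<Psi> k \<xi>)))
      \<longlonglongrightarrow> u up / 4 - u dn / 4"
  proof (rule Lim_transform_eventually)
    have cut: "(\<lambda>k. cutoff ?n (real k) \<eta>) \<longlonglongrightarrow> max 0 (1 - 0)" for \<eta>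
      unfolding cutoff_def by (intro tendsto_intros lim_const_over_n)
    have "(\<lambda>k. u up * cutoff ?n (real k) up / 4 - u dn * cutoff ?n (real k) dn / 4)
        \<longlonglongrightarrow> u up * of_real (max 0 (1 - 0)) / 4 - u dn * of_real (max 0 (1 - 0)) / 4"
      by (intro tendsto_intros cut) simp_all
    then show "(\<lambda>k. u up * cutoff ?n (real k) up / 4 - u dn * cutoff ?n (real k) dn / 4) \<longlonglongrightarrow> u up / 4 - u dn / 4"
      by simp
    show "\<forall>\<^sub>F k in sequentially. u up * cutoff ?n (real k) up / 4 - u dn * cutoff ?n (real k) dn / 4
        = (\<Sum>\<xi>\<in>lat_ball ?n (real k + 1). u \<xi> * cutoff ?n k \<xi> * (disc_lap_neg ?n (\<Psi> k) \<xi> - of_real lam * \<Psi> k \<xi>))"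
    proof (rule eventually_sequentiallyI)
      fix k assume k: "nat \<lceil>max (lat_norm ?n up) (lat_norm ?n dn)\<rceil> \<le> k"
      then have sub: "{up, dn} \<subseteq> lat_ball ?n (real k + 1)"
        using udL by (auto simp: lat_ball_def nat_le_iff ceiling_le_iff)
      have "(\<Sum>\<xi>\<in>lat_ball ?n (real k + 1). u \<xi> * cutoff ?n k \<xi> * (disc_lap_neg ?n (\<Psi> k) \<xi> - of_real lam * \<Psi> k \<xi>))
          = (\<Sum>\<xi>\<in>{up, dn}. u \<xi> * cutoff ?n k \<xi> * (disc_lap_neg ?n (\<Psi> k) \<xi> - of_real lam * \<Psi> k \<xi>))"
        by (rule sum.mono_neutral_right[OF finite_lat_ball sub]) (simp add: PPsi)
      also have "\<dots> = u up * cutoff ?n (real k) up / 4 - u dn * cutoff ?n (real k) dn / 4"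
        using ne sub by (simp add: PPsi)
      finally show "u up * cutoff ?n (real k) up / 4 - u dn * cutoff ?n (real k) dn / 4
        = (\<Sum>\<xi>\<in>lat_ball ?n (real k + 1). u \<xi> * cutoff ?n k \<xi> * (disc_lap_neg ?n (\<Psi> k) \<xi> - of_real lam * \<Psi> k \<xi>))" ..
    qed
  qed

  define A where "A = \<bar>real ?n - 2 * lam\<bar> + N"
  define \<gamma> where "\<gamma> = ln (2 * A + 1)"
  have g0: "\<gamma> \<ge> 0" by (simp add: \<gamma>_def A_def)
  define C where "C = 2 * exp (\<gamma> * (\<bar>m\<bar> + 1))"
  have C0: "C \<ge> 0" by (simp add: C_def)
  \<comment> \<open>The kernel of \<open>\<Psi> k\<close> with the bounded solution replaced by
    \<open>causal\<close>, which leaves the pairing with \<open>f\<close> unchanged.\<close>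
  define \<kappa> where "\<kappa> k \<xi> = (\<Sum>y\<in>Y k. plane N (x k y) (\<lambda>l. \<xi> l - \<xi>0 l) * causal (\<xi> N - m) (symb N lam (x k y))) / of_nat (L k ^ N)" for k \<xi>
  have causal_bound: "cmod (causal (\<xi> N - m) (symb N lam y)) \<le> C * exp (\<gamma> * l1 ?n \<xi>)" for \<xi> y
  proof -
    have "cmod (complex_of_real (symb N lam y)) \<le> A" using abs_symb_le[of N lam y] by (simp add: A_def)
    moreover have "\<bar>real_of_int (\<xi> N - m)\<bar> \<le> \<bar>m\<bar> + l1 ?n \<xi>" using abs_le_l1[of N ?n \<xi>] by simp
    ultimately have "cmod (causal (\<xi> N - m) (symb N lam y)) \<le> 2 * exp (\<gamma> * (\<bar>m\<bar> + l1 ?n \<xi> + 1))"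
      unfolding \<gamma>_def by (rule norm_causal_le)
    also have "\<dots> = C * exp (\<gamma> * l1 ?n \<xi>)" by (simp add: C_def algebra_simps flip: exp_add)
    finally show ?thesis .
  qed
  have fPsi: "(\<Sum>\<^sub>\<infinity>\<xi>\<in>lattice ?n. f \<xi> * \<Psi> k \<xi>) = (\<Sum>\<^sub>\<infinity>\<xi>\<in>lattice ?n. f \<xi> * \<kappa> k \<xi>)" for k
  proof -
    define q :: complex where "q = of_nat (L k ^ N)"
    have sG: "(\<lambda>\<xi>. f \<xi> * (plane N (x k y) \<xi> * (of_int (sgn (\<xi> N - m)) * Z (symb N lam (x k y)) ^ nat \<bar>\<xi> N - m\<bar>))) summable_on lattice ?n" for y
      by (rule f_bounded_summable[of _ 1]) (use G1 in \<open>simp add: norm_mult G_def\<close>)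
    have sC: "(\<lambda>\<xi>. f \<xi> * (plane N (x k y) \<xi> * causal (\<xi> N - m) (symb N lam (x k y)))) summable_on lattice ?n" for y
      by (rule f_mult_summable(2)[OF g0, of _ C]) (simp add: norm_mult causal_bound)
    have "(\<Sum>\<^sub>\<infinity>\<xi>\<in>lattice ?n. f \<xi> * \<Psi> k \<xi>)
        = (\<Sum>\<^sub>\<infinity>\<xi>\<in>lattice ?n. \<Sum>y\<in>Y k. (cnj (plane N (x k y) \<xi>0) / q) * (f \<xi> * (plane N (x k y) \<xi> * (of_int (sgn (\<xi> N - m)) * Z (symb N lam (x k y)) ^ nat \<bar>\<xi> N - m\<bar>))))"
      by (rule infsum_cong) (simp add: \<Psi>_def c_def G_def q_def x_def sum_divide_distrib sum_distrib_left mult_ac)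
    also have "\<dots> = (\<Sum>y\<in>Y k. (cnj (plane N (x k y) \<xi>0) / q) * (\<Sum>\<^sub>\<infinity>\<xi>\<in>lattice ?n. f \<xi> * (plane N (x k y) \<xi> * (of_int (sgn (\<xi> N - m)) * Z (symb N lam (x k y)) ^ nat \<bar>\<xi> N - m\<bar>))))"
      unfolding infsum_cmult_right'[symmetric] by (rule infsum_sum_finite[OF fY summable_on_cmult_right[OF sG]])
    also have "\<dots> = (\<Sum>y\<in>Y k. (cnj (plane N (x k y) \<xi>0) / q) * (\<Sum>\<^sub>\<infinity>\<xi>\<in>lattice ?n. f \<xi> * (plane N (x k y) \<xi> * causal (\<xi> N - m) (symb N lam (x k y)))))"
      by (simp only: inner_sum_causal[OF Z])
    also have "\<dots> = (\<Sum>\<^sub>\<infinity>\<xi>\<in>lattice ?n. \<Sum>y\<in>Y k. (cnj (plane N (x k y) \<xi>0) / q) * (f \<xi> * (plane N (x k y) \<xi> * causal (\<xi> N - m) (symb N lam (x k y)))))"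
      unfolding infsum_cmult_right'[symmetric] by (rule infsum_sum_finite[OF fY summable_on_cmult_right[OF sC], symmetric])
    also have "\<dots> = (\<Sum>\<^sub>\<infinity>\<xi>\<in>lattice ?n. f \<xi> * \<kappa> k \<xi>)"
      by (rule infsum_cong) (simp add: \<kappa>_def q_def plane_diff sum_divide_distrib sum_distrib_left mult_ac)
    finally show ?thesis .
  qed
  \<comment> \<open>By the triangle inequality, a point outside the cone is not in
    \<open>\<xi>0\<close> plus the cone either, so the kernel vanishes there; inside the cone
    \<open>f\<close> vanishes. The bound \<open>k\<close> on the l1 norm excludes
    wrap-around.\<close>
  have near: "f \<xi> * \<kappa> k \<xi> = 0" if \<xi>: "\<xi> \<in> lattice ?n" "l1 ?n \<xi> \<le> k" for \<xi> k
  proof (cases "\<xi> \<in> cone ?n")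
    case True then show ?thesis by (simp add: f_cone)
  next
    case False
    then have nc: "\<xi> N < (\<Sum>i<N. \<bar>\<xi> i\<bar>)" using \<xi> by (simp add: cone_def)
    have tot: "(\<Sum>l<?n. \<bar>\<xi> l\<bar>) \<le> int k"
      using \<xi>(2) unfolding l1_def by (simp flip: of_int_abs of_int_sum of_int_add)
    have "(\<Sum>y\<in>box_lat N {0..<int (L k)}. plane N (grid (\<lambda>_. 0) (L k) y) (\<lambda>l. \<xi> l - \<xi>0 l) * causal (\<xi> N - m) (symb N lam (grid (\<lambda>_. 0) (L k) y))) = 0"
    proof (rule sum_grid_causal_eq_0[OF L0])
      show "\<bar>\<xi> l - \<xi>0 l\<bar> + \<bar>\<xi> N - m\<bar> < int (L k)" if "l < N" for l
      proof -
        have "\<bar>\<xi> l\<bar> \<le> (\<Sum>l<N. \<bar>\<xi> l\<bar>)" using that by (intro member_le_sum) auto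
        then have "\<bar>\<xi> l\<bar> + \<bar>\<xi> N\<bar> \<le> int k" using tot by simp
        then show ?thesis using R[of l] R[of N] that by (simp add: L_def m_def)
      qed
      have "(\<Sum>l<N. \<bar>\<xi> l\<bar>) \<le> (\<Sum>l<N. \<bar>\<xi> l - \<xi>0 l\<bar> + \<bar>\<xi>0 l\<bar>)"
        by (rule sum_mono) auto
      then show "\<xi> N - m < (\<Sum>l<N. \<bar>\<xi> l - \<xi>0 l\<bar>)"
        using nc \<xi>0c by (simp add: sum.distrib)
    qed
    then show ?thesis by (simp add: \<kappa>_def Y_def x_def)
  qed
  have kb: "cmod (\<kappa> k \<xi>) \<le> C * exp (\<gamma> * l1 ?n \<xi>)" for k \<xi>
  proof -
    have "cmod (\<kappa> k \<xi>) = cmod (\<Sum>y\<in>Y k. plane N (x k y) (\<lambda>l. \<xi> l - \<xi>0 l) * causal (\<xi> N - m) (symb N lam (x k y))) / L k ^ N"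
      by (simp add: \<kappa>_def norm_divide norm_power)
    also have "\<dots> \<le> real (card (Y k)) * (C * exp (\<gamma> * l1 ?n \<xi>)) / L k ^ N"
      by (intro divide_right_mono sum_norm_bound) (auto simp: norm_mult causal_bound)
    also have "\<dots> = C * exp (\<gamma> * l1 ?n \<xi>)"
      using L0[of k] by (simp add: Y_def card_box_lat)
    finally show ?thesis .
  qed
  \<comment> \<open>Wrap-around may occur where the l1 norm exceeds \<open>k\<close>. There
    \<open>exp (l1 ?n \<xi>) / k \<ge> 1\<close>, and the decay of \<open>f\<close> pays for this
    extra exponential, so these points contribute O(1/k).\<close>
  have right: "(\<lambda>k. \<Sum>\<^sub>\<infinity>\<xi>\<in>lattice ?n. f \<xi> * \<Psi> k \<xi>) \<longlonglongrightarrow> 0"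
  proof (rule Lim_null_comparison)
    let ?F = "\<Sum>\<^sub>\<infinity>\<xi>\<in>lattice ?n. exp ((\<gamma> + 1) * l1 ?n \<xi>) * cmod (f \<xi>)"
    show "\<forall>\<^sub>F k in sequentially. norm (\<Sum>\<^sub>\<infinity>\<xi>\<in>lattice ?n. f \<xi> * \<Psi> k \<xi>) \<le> C * ?F / k"
      using eventually_gt_at_top[of 0]
    proof eventually_elim
      case (elim k)
      have abs: "(\<lambda>\<xi>. cmod (f \<xi> * \<kappa> k \<xi>)) summable_on lattice ?n"
        by (rule f_mult_summable(1)[OF g0 kb])
      have "norm (\<Sum>\<^sub>\<infinity>\<xi>\<in>lattice ?n. f \<xi> * \<kappa> k \<xi>) \<le> (\<Sum>\<^sub>\<infinity>\<xi>\<in>lattice ?n. cmod (f \<xi> * \<kappa> k \<xi>))"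
        by (rule norm_infsum_bound) (use abs in simp)
      also have "\<dots> \<le> (\<Sum>\<^sub>\<infinity>\<xi>\<in>lattice ?n. C / k * (exp ((\<gamma> + 1) * l1 ?n \<xi>) * cmod (f \<xi>)))"
      proof (rule infsum_mono)
        fix \<xi> assume \<xi>: "\<xi> \<in> lattice ?n"
        show "cmod (f \<xi> * \<kappa> k \<xi>) \<le> C / k * (exp ((\<gamma> + 1) * l1 ?n \<xi>) * cmod (f \<xi>))"
        proof (cases "l1 ?n \<xi> \<le> k")
          case True
          have "0 \<le> C / k * (exp ((\<gamma> + 1) * l1 ?n \<xi>) * cmod (f \<xi>))" using C0 by simp
          then show ?thesis by (simp only: near[OF \<xi> True] norm_zero)
        next
          case False
          then have "real k \<le> exp (l1 ?n \<xi>)"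
            using exp_ge_add_one_self[of "l1 ?n \<xi>"] by linarith
          then have "1 \<le> exp (l1 ?n \<xi>) / k" using elim by (simp add: field_simps)
          then have "C * exp (\<gamma> * l1 ?n \<xi>) * 1 \<le> C * exp (\<gamma> * l1 ?n \<xi>) * (exp (l1 ?n \<xi>) / k)"
            using C0 by (intro mult_left_mono) auto
          also have "\<dots> = C / k * exp ((\<gamma> + 1) * l1 ?n \<xi>)"
            by (simp add: distrib_right exp_add)
          finally have "cmod (\<kappa> k \<xi>) \<le> C / k * exp ((\<gamma> + 1) * l1 ?n \<xi>)"
            using kb[of k \<xi>] by linarith
          from mult_left_mono[OF this, of "cmod (f \<xi>)"] show ?thesis
            by (simp add: norm_mult mult_ac)
        qed
      next
        show "(\<lambda>\<xi>. C / k * (exp ((\<gamma> + 1) * l1 ?n \<xi>) * cmod (f \<xi>))) summable_on lattice ?n"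
          by (rule summable_on_cmult_right[OF f_summable]) (use g0 in simp)
      qed (rule abs)
      also have "\<dots> = C / k * ?F" by (rule infsum_cmult_right')
      finally show ?case unfolding fPsi by simp
    qed
    show "(\<lambda>k. C * ?F / real k) \<longlonglongrightarrow> 0" by (rule lim_const_over_n)
  qed
  have "(\<lambda>k. (\<Sum>\<xi>\<in>lat_ball ?n (real k + 1). u \<xi> * cutoff ?n k \<xi> * (disc_lap_neg ?n (\<Psi> k) \<xi> - of_real lam * \<Psi> k \<xi>))) \<longlonglongrightarrow> 0"
    using tendsto_add[OF lim right] by simp
  from LIMSEQ_unique[OF left this] show ?thesis by (simp add: up_def dn_def m_def)
qed

text \<open>On the points xi + 2 j e_n, which stay in the cone, \<open>u\<close> is constant. About
  R/2 of them lie in radius R, so the mean of |u|^2 cannot tend to 0 unless this constant is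
  0.\<close>

lemma u_eq_0_on_cone:
  assumes \<xi>: "\<xi> \<in> cone (Suc N)"
  shows "u \<xi> = 0"
proof -
  let ?n = "Suc N"
  define S where "S j = \<xi>(N := \<xi> N + 2 * int j)" for j :: nat
  have uS: "u (S j) = u \<xi>" for j
  proof (induction j)
    case 0
    then show ?case by (simp add: S_def)
  next
    case (Suc j)
    have "(\<Sum>i<N. \<bar>(\<xi>(N := v)) i\<bar>) = (\<Sum>i<N. \<bar>\<xi> i\<bar>)" for v
      by (rule sum.cong) auto
    \<comment> \<open>The periodicity is applied at the midpoint of two consecutive points of the
      sequence.\<close>
    then have "\<xi>(N := \<xi> N + 2 * int j + 1) \<in> cone ?n"
      using \<xi> by (simp add: cone_def lattice_def)
    from u_periodic_on_cone[OF this]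
    have "u (\<xi>(N := \<xi> N + 2 * int j + 2)) = u (S j)" by (simp add: S_def add_ac)
    moreover have "S (Suc j) = \<xi>(N := \<xi> N + 2 * int j + 2)"
      unfolding S_def by (rule arg_cong[of _ _ "\<lambda>v. \<xi>(N := v)"]) simp
    ultimately show ?case using Suc by metis
  qed
  have inj: "inj S"
  proof (rule injI)
    fix i j assume "S i = S j"
    from fun_cong[OF this, of N] show "i = j" by (simp add: S_def)
  qed
  have SL: "S j \<in> lattice ?n" for j using \<xi> by (auto simp: S_def cone_def intro: upd_in_lattice)
  have nS: "lat_norm ?n (S j) \<le> lat_norm ?n \<xi> + 2 * j" for j
    using lat_norm_upd_le[of ?n \<xi> N "2 * int j"] by (simp add: S_def)
  let ?U = "\<lambda>R. \<Sum>\<xi>\<in>lat_ball ?n R. (cmod (u \<xi>))\<^sup>2"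
  define r where "r = lat_norm ?n \<xi>"
  let ?R = "\<lambda>k::nat. r + 2 * real k"
  have "k * (cmod (u \<xi>))\<^sup>2 \<le> ?U (?R k)" for k
  proof -
    have "k * (cmod (u \<xi>))\<^sup>2 = (\<Sum>\<eta>\<in>S ` {..<k}. (cmod (u \<eta>))\<^sup>2)"
      using inj_on_subset[OF inj] by (subst sum.reindex) (auto simp: uS)
    also have "\<dots> \<le> ?U (?R k)"
    proof (rule sum_mono2[OF finite_lat_ball])
      show "S ` {..<k} \<subseteq> lat_ball ?n (?R k)"
        using SL by (auto simp: lat_ball_def r_def intro: order_trans[OF nS])
    qed auto
    finally show ?thesis .
  qed
  then have le: "k / ?R k * (cmod (u \<xi>))\<^sup>2 \<le> 1 / ?R k * ?U (?R k)" for k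
    using lat_norm_nonneg[of ?n \<xi>] by (simp add: divide_right_mono r_def)
  have "(\<lambda>k. 1 / ?R k * ?U (?R k)) \<longlonglongrightarrow> 0"
    by (rule filterlim_compose[OF mean_decay]) real_asymp
  moreover have "(\<lambda>k. real k / ?R k * (cmod (u \<xi>))\<^sup>2) \<longlonglongrightarrow> 1 / 2 * (cmod (u \<xi>))\<^sup>2"
    by (intro tendsto_mult tendsto_const) real_asymp
  ultimately have "1 / 2 * (cmod (u \<xi>))\<^sup>2 \<le> 0"
    using le by (intro LIMSEQ_le) auto
  then show ?thesis by simp
qed

end

theorem theorem8:
  fixes n :: nat and u f :: "(nat \<Rightarrow> int) \<Rightarrow> complex" and lam :: real
  assumes "n \<ge> 2"
    and "((\<lambda>R. (1/R) * (\<Sum>\<xi>\<in>{\<xi>\<in>lattice n. lat_norm n \<xi> \<le> R}. (cmod (u \<xi>))\<^sup>2))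
           \<longlongrightarrow> 0) at_top"
    and "(\<lambda>\<xi>. (cmod (f \<xi>))\<^sup>2) summable_on lattice n"
    and "\<And>\<gamma>. \<gamma> > 0 \<Longrightarrow> (\<lambda>\<xi>. (exp (\<gamma> * japanese n \<xi>) * cmod (f \<xi>))\<^sup>2) summable_on lattice n"
    and "\<And>\<xi>. \<xi> \<in> cone n \<Longrightarrow> f \<xi> = 0"
    and "0 < lam" and "lam < real n"
    and "\<And>\<xi>. \<xi> \<in> lattice n \<Longrightarrow> disc_lap_neg n u \<xi> - of_real lam * u \<xi> = f \<xi>"
  shows "\<forall>\<xi>\<in>cone n. u \<xi> = 0"
proof -
  obtain N where N: "n = Suc N" using assms(1) by (cases n) auto
  interpret rellich N u f lam
    by unfold_locales (use assms N in \<open>simp_all add: lat_ball_def\<close>)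
  show ?thesis using u_eq_0_on_cone N by blast
qed

end
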